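(* Let $n\ge 3$ be an integer. Every $P_n$-pivot-minor-free distance-hereditary graph has linear rank-width at most $2n-5$.
   Context: All graphs are finite, without loops or multiple edges. $P_n$ denotes the path on $n$ vertices. A graph $G$ is distance-hereditary if for every connected induced subgraph $H$ of $G$ and every two vertices $v,w$ of $H$, the distance between $v$ and $w$ in $H$ is the same as the distance in $G$. The local complementation at a vertex $u$ of $G$ replaces every edge of the subgraph induced by the neighbours of $u$ with a non-edge, and vice versa; the result is denoted $G*u$. Pivoting an edge $uv$ of $G$ gives $G\wedge uv = G*u*v*u$. A graph $H$ is a pivot-minor of $G$ if $H$ can be obtained from $G$ by a sequence of edge pivots and vertex deletions. A graph is $H$-pivot-minor-free if it has no pivot-minor isomorphic to $H$. For a graph $G$ with adjacency matrix $A_G$ and $X\subseteq V(G)$, let $\mathrm{cutrk}_G(X)$ be the rank over the binary field of the submatrix $A_G[X,V(G)\setminus X]$ with rows $X$ and columns $V(G)\setminus X$. The width of a linear ordering $(x_1,\ldots,x_n)$ of $V(G)$ is $\max_{1\le i\le n}\mathrm{cutrk}_G(\{x_1,\ldots,x_i\})$. The linear rank-width of $G$ is the minimum width over all linear orderings of $V(G)$. *)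

theory Defs
  imports "Graph_Theory.Graph_Theory" "HOL-Library.Z2" "HOL-Library.Function_Algebras"
begin

text \<open>
  A finite simple graph is a \<open>pair_graph\<close>: every edge \<open>uv\<close> is represented by the two arcs
  \<open>(u, v)\<close> and \<open>(v, u)\<close>.  The null graph is allowed.
\<close>

definition path_graph :: "nat \<Rightarrow> nat pair_pre_digraph" where
  "path_graph n = \<lparr> pverts = {..<n},
     parcs = {(i, j). i < n \<and> j < n \<and> (j = Suc i \<or> i = Suc j)} \<rparr>"


subsection \<open>Distance-hereditary graphs\<close>

definition graph_distance :: "'a pair_pre_digraph \<Rightarrow> 'a \<Rightarrow> 'a \<Rightarrow> ereal" where
  "graph_distance G u v = wf_digraph.\<mu> (with_proj G) (\<lambda>_. 1) u v"

definition distance_hereditary :: "'a pair_pre_digraph \<Rightarrow> bool" where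
  "distance_hereditary G \<longleftrightarrow>
     (\<forall>H :: 'a pair_pre_digraph.
        induced_subgraph (with_proj H) (with_proj G) \<and> connected (with_proj H) \<longrightarrow>
        (\<forall>v \<in> pverts H. \<forall>w \<in> pverts H. graph_distance H v w = graph_distance G v w))"


subsection \<open>Pivot-minors\<close>

definition local_complement :: "'a pair_pre_digraph \<Rightarrow> 'a \<Rightarrow> 'a pair_pre_digraph" where
  "local_complement G u =
     (let N = {(x, y). (u, x) \<in> parcs G \<and> (u, y) \<in> parcs G \<and> x \<noteq> y}
      in \<lparr> pverts = pverts G, parcs = (parcs G - N) \<union> (N - parcs G) \<rparr>)"

definition pivot :: "'a pair_pre_digraph \<Rightarrow> 'a \<Rightarrow> 'a \<Rightarrow> 'a pair_pre_digraph" where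
  "pivot G u v = local_complement (local_complement (local_complement G u) v) u"

definition delete_vertex :: "'a pair_pre_digraph \<Rightarrow> 'a \<Rightarrow> 'a pair_pre_digraph" where
  "delete_vertex G v =
     \<lparr> pverts = pverts G - {v}, parcs = {(x, y) \<in> parcs G. x \<noteq> v \<and> y \<noteq> v} \<rparr>"

inductive pivot_minor :: "'a pair_pre_digraph \<Rightarrow> 'a pair_pre_digraph \<Rightarrow> bool" where
  pivot_minor_refl: "pivot_minor G G"
| pivot_minor_pivot: "pivot_minor H G \<Longrightarrow> (u, v) \<in> parcs H \<Longrightarrow> pivot_minor (pivot H u v) G"
| pivot_minor_delete: "pivot_minor H G \<Longrightarrow> v \<in> pverts H \<Longrightarrow> pivot_minor (delete_vertex H v) G"

definition pivot_minor_free :: "'b pair_pre_digraph \<Rightarrow> 'a pair_pre_digraph \<Rightarrow> bool" where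
  "pivot_minor_free F G \<longleftrightarrow>
     (\<nexists>H. pivot_minor H G \<and> digraph_iso (with_proj H) (with_proj F))"


subsection \<open>Linear rank-width\<close>

text \<open>
  Matrices over the binary field have arbitrary sets of row and column indices.  The rank of
  \<open>M[X, Y]\<close> is the dimension of its row space, its rows being extended by zero outside \<open>Y\<close>.
\<close>

abbreviation bit_scale :: "bit \<Rightarrow> ('a \<Rightarrow> bit) \<Rightarrow> 'a \<Rightarrow> bit" where
  "bit_scale \<equiv> \<lambda>c f i. c * f i"

lemma vector_space_bit_scale: "vector_space bit_scale"
  by unfold_locales (auto simp: fun_eq_iff algebra_simps)

definition submatrix_rank :: "('r \<Rightarrow> 'c \<Rightarrow> bit) \<Rightarrow> 'r set \<Rightarrow> 'c set \<Rightarrow> nat" where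
  "submatrix_rank M X Y =
     vector_space.dim bit_scale ((\<lambda>x y. if y \<in> Y then M x y else 0) ` X)"

definition adjacency_matrix :: "'a pair_pre_digraph \<Rightarrow> 'a \<Rightarrow> 'a \<Rightarrow> bit" where
  "adjacency_matrix G x y = of_bool ((x, y) \<in> parcs G)"

definition cutrk :: "'a pair_pre_digraph \<Rightarrow> 'a set \<Rightarrow> nat" where
  "cutrk G X = submatrix_rank (adjacency_matrix G) X (pverts G - X)"

definition linear_ordering :: "'a pair_pre_digraph \<Rightarrow> 'a list \<Rightarrow> bool" where
  "linear_ordering G xs \<longleftrightarrow> distinct xs \<and> set xs = pverts G"

text \<open>The inserted 0 matters only for the null graph, whose empty ordering gets width 0.\<close>

definition ordering_width :: "'a pair_pre_digraph \<Rightarrow> 'a list \<Rightarrow> nat" where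
  "ordering_width G xs = Max (insert 0 ((\<lambda>i. cutrk G (set (take i xs))) ` {1..length xs}))"

definition linear_rank_width :: "'a pair_pre_digraph \<Rightarrow> nat" where
  "linear_rank_width G = Min (ordering_width G ` {xs. linear_ordering G xs})"

end

theory Submission
  imports Defs
begin

text \<open>
  A distance-hereditary graph is built from a vertex by adding pendant vertices and twins, and hence has a
  split decomposition into stars and cliques, which we root at a vertex.  If a path from the root down to a
  leaf of the decomposition passes \<open>s\<close> stars, then pivoting can re-centre these stars such that every one of
  them is traversed from leaf to leaf; each star then contributes one vertex to an induced path that starts at
  the root, and the path has \<open>s + 2\<close> vertices.  On the other hand, in a depth-first ordering of
  the leaves every star on the current path raises the cut-rank by at most 2, and the cliques together by at
  most 1, because a clique node repeats rows and columns that are already present.  So all cut-ranks are at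
  most \<open>2 s + 1\<close>, where \<open>s + 2 < n\<close>.
\<close>

subsection \<open>Pendant vertices and twins in distance-hereditary graphs\<close>

text \<open>A path is built from a leaf of the decomposition towards the root by putting a new
  vertex in front of the current root. This survives later pivots only if none of them uses the
  current root, and this ban is the obstacle: a star centred at the root (a \<open>union\<close>
  node) cannot be re-centred from inside its own part. There are three ways out. Below a clique
  node, a vertex of the sibling part is an adjacent twin of the root and can be pivoted in its
  place. Below another star, the parent's charge of 2 covers both stars, so the lower one is not
  counted. At the top, nothing is put in front of the root, so one initial pivot at it is harmless.
  This is why a part carries several invariants (\<open>weak_layout\<close>,
  \<open>twin_layout\<close>, \<open>rooted_layout\<close>), each tying an ordering and a path to
  the same number \<open>s\<close>. The summand 1 in \<open>2 * s + 1\<close> comes from a leaf, and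
  \<open>s \<le> n - 3\<close> turns it into \<open>2 * n - 5\<close>.\<close>

definition arcs_in :: "('a \<Rightarrow> 'a \<Rightarrow> bool) \<Rightarrow> 'a set \<Rightarrow> 'a rel" where
  "arcs_in E W = {(x, y). E x y \<and> x \<in> W \<and> y \<in> W}"

definition connected_in :: "('a \<Rightarrow> 'a \<Rightarrow> bool) \<Rightarrow> 'a set \<Rightarrow> bool" where
  "connected_in E W \<longleftrightarrow> (\<forall>x \<in> W. \<forall>y \<in> W. (x, y) \<in> (arcs_in E W)\<^sup>*)"

text \<open>Distances are compared through walk lengths: the shortest walk in \<open>X\<close> is at
  most as long as any walk in \<open>V\<close>, and the reverse bound is trivial because
  \<open>X \<subseteq> V\<close>.\<close>

definition dist_hered :: "('a \<Rightarrow> 'a \<Rightarrow> bool) \<Rightarrow> 'a set \<Rightarrow> bool" where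
  "dist_hered E V \<longleftrightarrow> (\<forall>X x y k. X \<subseteq> V \<and> connected_in E X \<and> x \<in> X \<and> y \<in> X \<and> (x, y) \<in> arcs_in E V ^^ k
     \<longrightarrow> (\<exists>j \<le> k. (x, y) \<in> arcs_in E X ^^ j))"

lemma arcs_in_mono: "V \<subseteq> W \<Longrightarrow> arcs_in E V \<subseteq> arcs_in E W"
  by (auto simp: arcs_in_def)

lemma relpow_subset: "R \<subseteq> S \<Longrightarrow> (x, y) \<in> R ^^ k \<Longrightarrow> (x, y) \<in> S ^^ k" for R S :: "'a rel"
  by (induction k arbitrary: y) auto

lemma dist_hered_subset: "dist_hered E V \<Longrightarrow> W \<subseteq> V \<Longrightarrow> dist_hered E W"
  unfolding dist_hered_def using relpow_subset[OF arcs_in_mono[of W V E]] by (metis subset_trans)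

locale simple_rel =
  fixes E :: "'a \<Rightarrow> 'a \<Rightarrow> bool"
  assumes sym: "E x y \<Longrightarrow> E y x" and irrefl: "\<not> E x x"
begin

lemma sym_iff: "E x y \<longleftrightarrow> E y x"
  using sym by blast

lemma sym_arcs_in: "(x, y) \<in> (arcs_in E W)\<^sup>* \<Longrightarrow> (y, x) \<in> (arcs_in E W)\<^sup>*"
proof -
  have "(arcs_in E W)\<inverse> = arcs_in E W" by (auto simp: arcs_in_def sym)
  then show "(x, y) \<in> (arcs_in E W)\<^sup>* \<Longrightarrow> (y, x) \<in> (arcs_in E W)\<^sup>*"
    by (metis rtrancl_converseI)
qed

lemma connected_in_root:
  assumes "u \<in> W" "\<And>x. x \<in> W \<Longrightarrow> (u, x) \<in> (arcs_in E W)\<^sup>*"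
  shows "connected_in E W"
  unfolding connected_in_def by (meson assms(2) rtrancl_trans sym_arcs_in)

lemma connected_in_Un:
  assumes "connected_in E P" "connected_in E Q" "p \<in> P" "q \<in> Q" "E p q"
  shows "connected_in E (P \<union> Q)"
proof (rule connected_in_root)
  show "p \<in> P \<union> Q" using assms by auto
  have mono: "(arcs_in E P)\<^sup>* \<subseteq> (arcs_in E (P \<union> Q))\<^sup>*" "(arcs_in E Q)\<^sup>* \<subseteq> (arcs_in E (P \<union> Q))\<^sup>*"
    by (auto intro!: rtrancl_mono arcs_in_mono)
  have pq: "(p, q) \<in> (arcs_in E (P \<union> Q))\<^sup>*" using assms by (auto simp: arcs_in_def)
  fix x assume "x \<in> P \<union> Q"
  then show "(p, x) \<in> (arcs_in E (P \<union> Q))\<^sup>*"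
  proof
    assume "x \<in> P" then show ?thesis using assms mono by (auto simp: connected_in_def)
  next
    assume "x \<in> Q"
    then have "(q, x) \<in> (arcs_in E (P \<union> Q))\<^sup>*" using assms mono by (auto simp: connected_in_def)
    then show ?thesis using pq by (rule rtrancl_trans[rotated])
  qed
qed

lemma connected_in_singleton: "connected_in E {x}"
  by (simp add: connected_in_def)

lemma connected_in_insert: "connected_in E P \<Longrightarrow> p \<in> P \<Longrightarrow> E p x \<Longrightarrow> connected_in E (insert x P)"
  using connected_in_Un[of P "{x}" p x] by (simp add: connected_in_singleton)

lemma connected_in_pair: "E x y \<Longrightarrow> connected_in E {x, y}"
  using connected_in_insert[of "{y}" y x] by (simp add: connected_in_singleton sym)

lemma connected_in_path4: "E a b \<Longrightarrow> E b c \<Longrightarrow> E c d \<Longrightarrow> connected_in E {a, b, c, d}"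
  using connected_in_insert[OF connected_in_insert[OF connected_in_pair[of c d], of c b], of b a]
  by (simp add: sym)

definition component :: "'a set \<Rightarrow> 'a \<Rightarrow> 'a set" where
  "component W x = {y. (x, y) \<in> (arcs_in E W)\<^sup>*}"

lemma component_self: "x \<in> component W x"
  by (simp add: component_def)

lemma component_subset: "x \<in> W \<Longrightarrow> component W x \<subseteq> W"
  by (auto simp: component_def arcs_in_def elim: rtranclE)

lemma component_closed: "y \<in> component W x \<Longrightarrow> x \<in> W \<Longrightarrow> E y z \<Longrightarrow> z \<in> W \<Longrightarrow> z \<in> component W x"
  using component_subset[of x W]
  by (auto simp: component_def arcs_in_def intro: rtrancl_into_rtrancl)

lemma connected_component:
  assumes "x \<in> W" shows "connected_in E (component W x)"
proof (rule connected_in_root[OF component_self])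
  fix y assume "y \<in> component W x"
  then have "(x, y) \<in> (arcs_in E W)\<^sup>*" by (simp add: component_def)
  then show "(x, y) \<in> (arcs_in E (component W x))\<^sup>*"
  proof induction
    case (step y z)
    then have "y \<in> component W x" "z \<in> component W x"
      by (auto simp: component_def intro: rtrancl_into_rtrancl)
    then have "(y, z) \<in> arcs_in E (component W x)" using step by (auto simp: arcs_in_def)
    then show ?case using step by auto
  qed simp
qed

text \<open>Every later contradiction uses this form: two non-adjacent vertices with a common
  neighbour in \<open>V\<close> must have one in each connected set that contains both.\<close>

lemma dist_hered_two_step:
  assumes "dist_hered E V" "X \<subseteq> V" "connected_in E X" "x \<in> X" "y \<in> X" "x \<noteq> y" "\<not> E x y"
    and "c \<in> V" "E x c" "E c y"
  obtains c' where "c' \<in> X" "E x c'" "E c' y"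
proof -
  have "(x, y) \<in> arcs_in E V ^^ 2"
    using assms by (auto simp: arcs_in_def numeral_2_eq_2)
  then obtain j where j: "j \<le> 2" "(x, y) \<in> arcs_in E X ^^ j"
    using assms unfolding dist_hered_def by blast
  have "j = 2"
  proof (rule ccontr)
    assume "j \<noteq> 2"
    then consider "j = 0" | "j = 1" using j by linarith
    then show False using j assms by cases (auto simp: arcs_in_def)
  qed
  then show thesis using j that by (auto simp: arcs_in_def numeral_2_eq_2)
qed

end

section \<open>Cographs: graphs without an induced path on four vertices have twins\<close>

definition p4_free :: "('a \<Rightarrow> 'a \<Rightarrow> bool) \<Rightarrow> 'a set \<Rightarrow> bool" where
  "p4_free e S \<longleftrightarrow> (\<nexists>a b c d. {a, b, c, d} \<subseteq> S \<and> distinct [a, b, c, d] \<and>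
     e a b \<and> e b c \<and> e c d \<and> \<not> e a c \<and> \<not> e a d \<and> \<not> e b d)"

lemma p4_free_subset: "p4_free e S \<Longrightarrow> T \<subseteq> S \<Longrightarrow> p4_free e T"
  unfolding p4_free_def by (meson subset_trans)

text \<open>The path on four vertices is self-complementary: if the non-edges of \<open>e\<close>
  form the path a, b, c, d, then its edges form the path b, d, a, c.\<close>

lemma p4_free_complement:
  assumes "\<And>x y. e x y = e y x" "p4_free e S" shows "p4_free (\<lambda>x y. \<not> e x y) S"
  unfolding p4_free_def
proof (intro notI, elim exE conjE)
  fix a b c d
  assume "{a, b, c, d} \<subseteq> S" "distinct [a, b, c, d]" "\<not> e a b" "\<not> e b c" "\<not> e c d"
    "\<not> \<not> e a c" "\<not> \<not> e a d" "\<not> \<not> e b d"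
  then have "{b, d, a, c} \<subseteq> S \<and> distinct [b, d, a, c] \<and> e b d \<and> e d a \<and> e a c \<and> \<not> e b a \<and> \<not> e b c \<and> \<not> e d c"
    using assms(1) by auto
  then show False using assms(2) unfolding p4_free_def by blast
qed

text \<open>In graph terms: the graph or its complement is disconnected.\<close>

definition homogeneous_split :: "('a \<Rightarrow> 'a \<Rightarrow> bool) \<Rightarrow> 'a set \<Rightarrow> bool" where
  "homogeneous_split e S \<longleftrightarrow> (\<exists>S1 S2. S = S1 \<union> S2 \<and> S1 \<inter> S2 = {} \<and> S1 \<noteq> {} \<and> S2 \<noteq> {} \<and>
     ((\<forall>x \<in> S1. \<forall>y \<in> S2. e x y) \<or> (\<forall>x \<in> S1. \<forall>y \<in> S2. \<not> e x y)))"

lemma homogeneous_split_complement: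
  "homogeneous_split (\<lambda>x y. \<not> e x y) S \<longleftrightarrow> homogeneous_split e S"
  unfolding homogeneous_split_def by (intro iff_exI) auto

lemma homogeneous_splitI:
  assumes "S = S1 \<union> S2" "S1 \<inter> S2 = {}" "S1 \<noteq> {}" "S2 \<noteq> {}"
    and "(\<forall>x \<in> S1. \<forall>y \<in> S2. e x y) \<or> (\<forall>x \<in> S1. \<forall>y \<in> S2. \<not> e x y)"
  shows "homogeneous_split e S"
  using assms unfolding homogeneous_split_def by blast

text \<open>A neighbour \<open>c\<close> of \<open>v\<close> on one side of the split and an edge on the other side between a neighbour
  and a non-neighbour of \<open>v\<close> would form a \<open>P\<^sub>4\<close>.\<close>

lemma homogeneous_split_insert_aux:
  assumes sym: "\<And>x y. e x y = e y x" and p4: "p4_free e (insert v (S1 \<union> S2))"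
    and v: "v \<notin> S1 \<union> S2" and S: "S1 \<inter> S2 = {}"
    and no: "\<forall>x \<in> S1. \<forall>y \<in> S2. \<not> e x y"
    and b: "b \<in> S1" "\<not> e v b" and c: "c \<in> S2" "e v c"
  shows "homogeneous_split e (insert v (S1 \<union> S2))"
proof -
  let ?M = "{x \<in> S1. \<not> e v x}"
  have none: "\<not> e a m" if "a \<in> S1" "e v a" "m \<in> ?M" for a m
  proof
    assume "e a m"
    then have "{c, v, a, m} \<subseteq> insert v (S1 \<union> S2) \<and> distinct [c, v, a, m] \<and>
      e c v \<and> e v a \<and> e a m \<and> \<not> e c a \<and> \<not> e c m \<and> \<not> e v m"
      using that c v S no sym by auto
    then show False using p4 unfolding p4_free_def by blast
  qed
  show ?thesis
  proof (rule homogeneous_splitI[of _ ?M "insert v (S1 \<union> S2) - ?M"])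
    show "(\<forall>x\<in>?M. \<forall>y\<in>insert v (S1 \<union> S2) - ?M. e x y) \<or> (\<forall>x\<in>?M. \<forall>y\<in>insert v (S1 \<union> S2) - ?M. \<not> e x y)"
      using none no sym by blast
  qed (use b c v in auto)
qed

text \<open>If \<open>v\<close> sees all of \<open>S\<close>, it can be split off; if it misses a
  whole side, that side can be. Otherwise \<open>v\<close> has neighbours on both sides and misses a
  vertex of one of them, which is the situation of
  \<open>homogeneous_split_insert_aux\<close>.\<close>

lemma homogeneous_split_insert:
  assumes sym: "\<And>x y. e x y = e y x" and p4: "p4_free e (insert v S)" and v: "v \<notin> S"
    and S: "S = S1 \<union> S2" "S1 \<inter> S2 = {}" "S1 \<noteq> {}" "S2 \<noteq> {}"
    and no: "\<forall>x \<in> S1. \<forall>y \<in> S2. \<not> e x y"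
  shows "homogeneous_split e (insert v S)"
proof -
  have no': "\<forall>x \<in> S2. \<forall>y \<in> S1. \<not> e x y" using no sym by blast
  consider "\<forall>x\<in>S. e v x" | "\<forall>x\<in>S1. \<not> e v x" | "\<forall>x\<in>S2. \<not> e v x"
    | b c where "b \<in> S1" "\<not> e v b" "c \<in> S2" "e v c" | b c where "b \<in> S2" "\<not> e v b" "c \<in> S1" "e v c"
    using S by blast
  then show ?thesis
  proof cases
    case 1
    show ?thesis by (rule homogeneous_splitI[of _ "{v}" S]) (use 1 v S in auto)
  next
    case 2
    show ?thesis by (rule homogeneous_splitI[of _ S1 "insert v S2"]) (use 2 v S no sym in auto)
  next
    case 3
    show ?thesis by (rule homogeneous_splitI[of _ S2 "insert v S1"]) (use 3 v S no' sym in auto)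
  next
    case 4
    then show ?thesis using homogeneous_split_insert_aux[of e v S1 S2 b c] sym p4 v S no by simp
  next
    case 5
    then show ?thesis using homogeneous_split_insert_aux[of e v S2 S1 b c] sym p4 v S no'
      by (simp add: Un_commute Int_commute)
  qed
qed

text \<open>Seinsche's theorem on cographs, by adding one vertex at a time. A split with all edges
  becomes one without edges after complementation.\<close>

lemma p4_free_homogeneous_split:
  assumes sym: "\<And>x y. e x y = e y x" and "finite S" "card S \<ge> 2" "p4_free e S"
  shows "homogeneous_split e S"
  using assms(2-)
proof (induction S rule: finite_induct)
  case (insert v S)
  show ?case
  proof (cases "card S \<ge> 2")
    case False
    then have "card S = 1" using insert by simp
    then obtain w where "S = {w}" by (auto simp: card_Suc_eq numeral_eq_Suc)
    then show ?thesis using insert by (intro homogeneous_splitI[of _ "{v}" "{w}"]) auto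
  next
    case True
    then have "homogeneous_split e S"
      using insert p4_free_subset[of e "insert v S" S] by blast
    then obtain S1 S2 where S: "S = S1 \<union> S2" "S1 \<inter> S2 = {}" "S1 \<noteq> {}" "S2 \<noteq> {}"
      and *: "(\<forall>x \<in> S1. \<forall>y \<in> S2. e x y) \<or> (\<forall>x \<in> S1. \<forall>y \<in> S2. \<not> e x y)"
      unfolding homogeneous_split_def by blast
    from * show ?thesis
    proof
      assume "\<forall>x \<in> S1. \<forall>y \<in> S2. \<not> e x y"
      then show ?thesis using homogeneous_split_insert[OF sym insert(5) insert(2) S] by blast
    next
      assume "\<forall>x \<in> S1. \<forall>y \<in> S2. e x y"
      then have "homogeneous_split (\<lambda>x y. \<not> e x y) (insert v S)"
        using homogeneous_split_insert[OF _ p4_free_complement[OF sym insert(5)] insert(2) S] sym by simp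
      then show ?thesis by (simp add: homogeneous_split_complement)
    qed
  qed
qed simp

text \<open>Twins within one side of a homogeneous split remain twins in \<open>S\<close>, since a
  vertex of the other side sees all or nothing of that side. So the induction descends into a side
  with at least two vertices.\<close>

lemma p4_free_twins:
  assumes sym: "\<And>x y. e x y = e y x"
  shows "finite S \<Longrightarrow> card S \<ge> 2 \<Longrightarrow> p4_free e S \<Longrightarrow>
    \<exists>x \<in> S. \<exists>y \<in> S. x \<noteq> y \<and> (\<forall>z \<in> S - {x, y}. e x z = e y z)"
proof (induction "card S" arbitrary: S rule: less_induct)
  case less
  obtain S1 S2 where S: "S = S1 \<union> S2" "S1 \<inter> S2 = {}" "S1 \<noteq> {}" "S2 \<noteq> {}"
    and *: "(\<forall>x \<in> S1. \<forall>y \<in> S2. e x y) \<or> (\<forall>x \<in> S1. \<forall>y \<in> S2. \<not> e x y)"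
    using p4_free_homogeneous_split[OF sym less.prems] unfolding homogeneous_split_def by blast
  have fin: "finite S1" "finite S2" using S less.prems by auto
  have card: "card S = card S1 + card S2" using S fin by (simp add: card_Un_disjoint)
  have pos: "card S1 > 0" "card S2 > 0" using S fin by (auto simp: card_gt_0_iff)
  have lift: "\<exists>x \<in> S. \<exists>y \<in> S. x \<noteq> y \<and> (\<forall>z \<in> S - {x, y}. e x z = e y z)"
    if T: "T \<subseteq> S" "card T < card S" "card T \<ge> 2" and hom: "\<And>x y z. x \<in> T \<Longrightarrow> y \<in> T \<Longrightarrow> z \<in> S - T \<Longrightarrow> e x z = e y z" for T
  proof -
    have "finite T" "p4_free e T"
      using T less.prems finite_subset p4_free_subset[of e S T] by auto
    then have "\<exists>x \<in> T. \<exists>y \<in> T. x \<noteq> y \<and> (\<forall>z \<in> T - {x, y}. e x z = e y z)"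
      using less.hyps[of T] T by simp
    then obtain x y where xy: "x \<in> T" "y \<in> T" "x \<noteq> y" "\<forall>z \<in> T - {x, y}. e x z = e y z"
      by auto
    have "e x z = e y z" if "z \<in> S - {x, y}" for z
      using xy hom[of x y z] that by (cases "z \<in> T") auto
    moreover have "x \<in> S" "y \<in> S" using xy T by auto
    ultimately show ?thesis using xy(3) by metis
  qed
  consider "card S1 \<ge> 2" | "card S2 \<ge> 2" | "card S1 = 1" "card S2 = 1" using pos by linarith
  then show ?case
  proof cases
    case 1
    have hom: "e x z = e y z" if "x \<in> S1" "y \<in> S1" "z \<in> S - S1" for x y z
      using * S that by auto
    have sub: "S1 \<subseteq> S" "card S1 < card S" using S card pos by auto
    show ?thesis by (rule lift[OF sub 1 hom])
  next
    case 2
    have hom: "e x z = e y z" if "x \<in> S2" "y \<in> S2" "z \<in> S - S2" for x y z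
      using * S that sym[of x z] sym[of y z] by auto
    have sub: "S2 \<subseteq> S" "card S2 < card S" using S card pos by auto
    show ?thesis by (rule lift[OF sub 2 hom])
  next
    case 3
    obtain x where x: "S1 = {x}" using 3(1) by (rule card_1_singletonE)
    obtain y where y: "S2 = {y}" using 3(2) by (rule card_1_singletonE)
    have "x \<in> S" "y \<in> S" "x \<noteq> y" "S - {x, y} = {}" using S x y by auto
    then show ?thesis by (metis empty_iff)
  qed
qed


section \<open>Distance layers around a root vertex\<close>

locale rooted_dist_hered = simple_rel E for E :: "'a \<Rightarrow> 'a \<Rightarrow> bool" +
  fixes V :: "'a set" and u :: 'a
  assumes dh: "dist_hered E V" and conn: "connected_in E V" and root: "u \<in> V"
begin

definition depth :: "'a \<Rightarrow> nat" where
  "depth x = (LEAST k. (u, x) \<in> arcs_in E V ^^ k)"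

lemma walk_depth: "x \<in> V \<Longrightarrow> (u, x) \<in> arcs_in E V ^^ depth x"
proof -
  assume "x \<in> V"
  then obtain k where "(u, x) \<in> arcs_in E V ^^ k"
    using conn root unfolding connected_in_def by (meson rtrancl_imp_relpow)
  then show ?thesis unfolding depth_def by (rule LeastI)
qed

lemma depth_le: "(u, x) \<in> arcs_in E V ^^ k \<Longrightarrow> depth x \<le> k"
  unfolding depth_def by (rule Least_le)

lemma depth_root: "depth u = 0"
  using depth_le[of u 0] by simp

lemma depth_0: "x \<in> V \<Longrightarrow> depth x = 0 \<Longrightarrow> x = u"
  using walk_depth[of x] by simp

lemma depth_edge: "x \<in> V \<Longrightarrow> y \<in> V \<Longrightarrow> E x y \<Longrightarrow> depth y \<le> Suc (depth x)"
  using walk_depth[of x] by (intro depth_le[of y "Suc (depth x)"]) (auto simp: arcs_in_def)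

text \<open>By heredity a shortest walk from \<open>u\<close> inside \<open>X\<close> has length
  \<open>depth w\<close>, so its last step comes from the layer just above \<open>w\<close>.\<close>

lemma lower_neighbour:
  assumes X: "X \<subseteq> V" "connected_in E X" "u \<in> X" and w: "w \<in> X" "w \<noteq> u"
  obtains w' where "w' \<in> X" "E w' w" "depth w = Suc (depth w')"
proof -
  obtain j where j: "j \<le> depth w" "(u, w) \<in> arcs_in E X ^^ j"
    using dh X w walk_depth[of w] unfolding dist_hered_def by blast
  then obtain i where i: "j = Suc i" using w by (cases j) auto
  then obtain w' where w': "(u, w') \<in> arcs_in E X ^^ i" "(w', w) \<in> arcs_in E X"
    using j by auto
  have "depth w' \<le> i"
    using relpow_subset[OF arcs_in_mono[OF X(1)] w'(1)] by (rule depth_le)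
  moreover have "depth w \<le> Suc (depth w')"
    using depth_edge[of w' w] w' X by (auto simp: arcs_in_def)
  ultimately have "depth w = Suc (depth w')" using j i by linarith
  then show thesis using that w' by (auto simp: arcs_in_def)
qed

lemma geodesic:
  "z \<in> V \<Longrightarrow> \<exists>P \<subseteq> V. connected_in E P \<and> u \<in> P \<and> z \<in> P \<and> (\<forall>p \<in> P. p \<noteq> z \<longrightarrow> depth p < depth z)"
proof (induction "depth z" arbitrary: z)
  case 0
  then have "z = u" using depth_0 by simp
  then show ?case using root by (intro exI[of _ "{u}"]) (simp add: connected_in_singleton)
next
  case (Suc n)
  then have "z \<noteq> u" using depth_root by auto
  then obtain z' where z': "z' \<in> V" "E z' z" "depth z = Suc (depth z')"
    using lower_neighbour[of V z] conn root Suc by blast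
  then obtain P where P: "P \<subseteq> V" "connected_in E P" "u \<in> P" "z' \<in> P"
    "\<forall>p \<in> P. p \<noteq> z' \<longrightarrow> depth p < depth z'"
    using Suc.hyps(1)[of z'] Suc.hyps(2) by auto
  show ?case
  proof (intro exI[of _ "insert z P"] conjI)
    show "connected_in E (insert z P)" using P z' connected_in_insert by blast
    show "\<forall>p \<in> insert z P. p \<noteq> z \<longrightarrow> depth p < depth z"
      using P(5) z'(3) by (metis insert_iff less_Suc_eq)
  qed (use P Suc.prems in auto)
qed

text \<open>Join \<open>Q\<close> to a geodesic from \<open>u\<close> to \<open>z\<close>. In this
  connected set \<open>y\<close> needs a neighbour in the layer of \<open>z\<close>;
  \<open>Q\<close> lies too deep, and the geodesic meets that layer only in
  \<open>z\<close>.\<close>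

lemma same_lower_neighbours:
  assumes Q: "Q \<subseteq> V" "connected_in E Q" "\<And>q. q \<in> Q \<Longrightarrow> depth x \<le> depth q"
    and x: "x \<in> Q" and y: "y \<in> Q" "depth y = depth x"
    and z: "z \<in> V" "E z x" "depth x = Suc (depth z)"
  shows "E z y"
proof -
  obtain P where P: "P \<subseteq> V" "connected_in E P" "u \<in> P" "z \<in> P"
    "\<And>p. p \<in> P \<Longrightarrow> p \<noteq> z \<Longrightarrow> depth p < depth z"
    using geodesic[OF z(1)] by blast
  have "connected_in E (P \<union> Q)" using connected_in_Un[of P Q z x] P Q x z by blast
  moreover have "y \<noteq> u" using y z depth_root by auto
  ultimately obtain w where w: "w \<in> P \<union> Q" "E w y" "depth y = Suc (depth w)"
    using lower_neighbour[of "P \<union> Q" y] P Q y by blast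
  then have "w \<notin> Q" using Q(3)[of w] y by auto
  moreover have "depth w = depth z" using w y z by simp
  ultimately have "w = z" using w P(5)[of w] by auto
  then show ?thesis using w by simp
qed

text \<open>The ends of an induced path on four vertices would have distance 2 through
  \<open>z\<close>, but 3 within the path.\<close>

lemma p4_free_neighbourhood:
  assumes "S \<subseteq> V" "z \<in> V" "\<And>x. x \<in> S \<Longrightarrow> E z x"
  shows "p4_free E S"
  unfolding p4_free_def
proof (intro notI, elim exE conjE)
  fix a b c d
  assume *: "{a, b, c, d} \<subseteq> S" "distinct [a, b, c, d]" "E a b" "E b c" "E c d"
    "\<not> E a c" "\<not> E a d" "\<not> E b d"
  have con: "connected_in E {d, c, b, a}"
    using connected_in_path4[of d c b a] * sym by blast
  obtain c' where "c' \<in> {d, c, b, a}" "E a c'" "E c' d"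
    by (rule dist_hered_two_step[OF dh _ con, of a d z]) (use * assms sym_iff in auto)
  then show False using * irrefl by auto
qed

end

text \<open>\<open>removable E V x y t\<close>: in \<open>V\<close>, the vertex \<open>x\<close> is a twin of \<open>y\<close> if \<open>t\<close> holds, and pendant at \<open>y\<close> otherwise.\<close>

definition removable :: "('a \<Rightarrow> 'a \<Rightarrow> bool) \<Rightarrow> 'a set \<Rightarrow> 'a \<Rightarrow> 'a \<Rightarrow> bool \<Rightarrow> bool" where
  "removable E V x y t \<longleftrightarrow> x \<in> V \<and> y \<in> V \<and> x \<noteq> y \<and> (\<not> t \<longrightarrow> E x y) \<and> (\<forall>z \<in> V - {x, y}. E x z = (t \<and> E y z))"

context rooted_dist_hered begin

text \<open>The neighbourhood of \<open>x\<close> is a module: a vertex outside it, other than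
  \<open>x\<close>, sees all of it or nothing. Hence twins within the neighbourhood are twins in the
  whole graph.\<close>

lemma deepest_neighbours_module:
  assumes k: "\<And>v. v \<in> V \<Longrightarrow> depth v \<le> k" and x: "x \<in> V" "depth x = k"
    and low: "\<And>z. z \<in> V \<Longrightarrow> E z x \<Longrightarrow> k = Suc (depth z)"
    and min: "\<And>y. y \<in> V \<Longrightarrow> depth y = k \<Longrightarrow>
      card {z \<in> V. E z x \<and> k = Suc (depth z)} \<le> card {z \<in> V. E z y \<and> k = Suc (depth z)}"
    and fin: "finite V"
    and ab: "a \<in> V" "E a x" "b \<in> V" "E b x" "a \<noteq> b" and z: "z \<in> V" "\<not> E z x" "z \<noteq> x" "E z a"
  shows "E z b"
proof (rule ccontr)
  assume nzb: "\<not> E z b"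
  have da: "k = Suc (depth a)" "k = Suc (depth b)" using low ab by auto
  have "depth b \<noteq> 0"
    using depth_0[of a] depth_0[of b] da ab by auto
  then have "b \<noteq> u" using depth_root by auto
  then obtain t where t: "t \<in> V" "E t b" "depth b = Suc (depth t)"
    using lower_neighbour[of V b] conn root ab by blast
  have nxt: "\<not> E t x" using low t da by force
  have cab: "connected_in E {a, x, b}"
    using ab connected_in_insert[OF connected_in_pair[of x b], of x a] sym_iff by simp
  have xa: "E x a" "E x b" using ab sym_iff by auto
  have ta: "E t a"
    by (rule same_lower_neighbours[OF _ cab, of b]) (use ab x t da in auto)
  have dz: "depth z \<le> k" "depth a \<le> Suc (depth z)" using k z depth_edge[of z a] ab by auto
  consider "depth z = k" | "Suc (depth z) = k" | "Suc (depth z) = depth a"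
    using dz da by linarith
  then show False
  proof cases
    case 1
    let ?N = "\<lambda>y. {z \<in> V. E z y \<and> k = Suc (depth z)}"
    \<comment> \<open>\<open>?N z\<close> misses \<open>b\<close>, which lies in
      \<open>?N x\<close>, so by minimality of \<open>?N x\<close> it must contain a vertex
      \<open>e\<close> outside \<open>?N x\<close>.\<close>
    have "\<not> ?N z \<subseteq> ?N x"
    proof
      assume "?N z \<subseteq> ?N x"
      moreover have "b \<in> ?N x" "b \<notin> ?N z" using ab da nzb sym_iff by auto
      ultimately have "card (?N z) < card (?N x)" using fin by (intro psubset_card_mono) auto
      then show False using min[OF z(1) 1] by simp
    qed
    then obtain e where e: "e \<in> V" "E e z" "k = Suc (depth e)" "\<not> E e x" by blast
    have caze: "connected_in E {a, z, e}"
      using z e connected_in_insert[OF connected_in_pair[of z e], of z a] sym_iff by simp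
    have te: "E t e"
      by (rule same_lower_neighbours[OF _ caze, of a]) (use ab z t e ta da 1 in auto)
    have nzt: "\<not> E t z" using depth_edge[of t z] t z 1 da by auto
    \<comment> \<open>The walk z, e, t, b, x avoids \<open>a\<close>, and none of its vertices is
      adjacent to both \<open>x\<close> and \<open>z\<close>, although \<open>a\<close> is.\<close>
    have con: "connected_in E {z, e, t, b, x}"
      using connected_in_insert[OF connected_in_path4[of e t b x], of e z] ab e t te sym by simp
    obtain c' where "c' \<in> {z, e, t, b, x}" "E x c'" "E c' z"
      by (rule dist_hered_two_step[OF dh _ con, of x z a]) (use ab e t z x sym_iff in auto)
    then show False using irrefl e nxt nzb nzt z sym_iff by auto
  next
    case 2
    have cza: "connected_in E {z, a}" using z connected_in_pair by blast
    have tz: "E t z"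
      by (rule same_lower_neighbours[OF _ cza, of a]) (use ab z t ta da 2 in auto)
    have con: "connected_in E {z, t, b, x}"
      using connected_in_path4[of z t b x] ab t tz sym by blast
    obtain c' where "c' \<in> {z, t, b, x}" "E z c'" "E c' x"
      by (rule dist_hered_two_step[OF dh _ con, of z x a]) (use ab t z x sym_iff in auto)
    then show False using irrefl nxt nzb z by auto
  next
    case 3
    have "E z b"
      by (rule same_lower_neighbours[OF _ cab, of a]) (use ab x z da 3 in auto)
    then show False using nzb by simp
  qed
qed

text \<open>The theorem of Bandelt and Mulder. Take \<open>x\<close> in the deepest layer with
  fewest lower neighbours, and let \<open>R\<close> be its component in that layer. If
  \<open>R\<close> has more vertices, they share their lower neighbours, so \<open>R\<close> is a
  cograph and its twins are twins in \<open>V\<close>. If \<open>R\<close> is only \<open>x\<close>,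
  the neighbourhood of \<open>x\<close> is a cograph and a module and yields twins, unless
  \<open>x\<close> is pendant.\<close>

lemma ex_removable:
  assumes fin: "finite V" and card: "card V \<ge> 2"
  shows "\<exists>x y t. removable E V x y t"
proof -
  define k where "k = Max (depth ` V)"
  have k: "depth v \<le> k" if "v \<in> V" for v using fin that by (auto simp: k_def)
  have "k \<in> depth ` V" using fin root unfolding k_def by (intro Max_in) auto
  then obtain x0 where x0: "x0 \<in> V" "depth x0 = k" by auto
  define N where "N y = {z \<in> V. E z y \<and> k = Suc (depth z)}" for y
  obtain x where x: "x \<in> V" "depth x = k"
    and min: "\<And>y. y \<in> V \<Longrightarrow> depth y = k \<Longrightarrow> card (N x) \<le> card (N y)"
    using ex_has_least_nat[of "\<lambda>y. y \<in> V \<and> depth y = k" x0 "\<lambda>y. card (N y)"] x0 by blast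
  have kpos: "k \<noteq> 0"
  proof
    assume "k = 0"
    then have "V = {u}" using k depth_0 root by fastforce
    then show False using card by simp
  qed
  define L where "L = {v \<in> V. depth v = k}"
  define R where "R = component L x"
  have xL: "x \<in> L" using x by (simp add: L_def)
  have RL: "R \<subseteq> L" "x \<in> R" "connected_in E R"
    unfolding R_def using component_subset[OF xL] component_self connected_component[OF xL] by auto
  have RV: "R \<subseteq> V" using RL by (auto simp: L_def)
  have dR: "depth y = k" if "y \<in> R" for y using that RL by (auto simp: L_def)
  have "x \<noteq> u" using x kpos depth_root by auto
  then obtain n where n: "n \<in> V" "E n x" "depth x = Suc (depth n)"
    using lower_neighbour[of V x] conn root x by blast
  have NR: "E z y'" if "z \<in> V" "depth z \<noteq> k" "y \<in> R" "y' \<in> R" "E z y" for y y' z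
  proof (rule same_lower_neighbours[OF RV RL(3), of y])
    show "depth y = Suc (depth z)"
      using depth_edge[of z y] k[of z] that dR RV by auto
  qed (use that dR in auto)
  show ?thesis
  proof (cases "card R \<ge> 2")
    case True
    have "p4_free E R"
      by (rule p4_free_neighbourhood[OF RV n(1)]) (use NR[OF n(1) _ RL(2)] n x in auto)
    then obtain y y' where y: "y \<in> R" "y' \<in> R" "y \<noteq> y'" "\<forall>z \<in> R - {y, y'}. E y z = E y' z"
      using p4_free_twins[of E R] sym_iff finite_subset[OF RV fin] True by blast
    have "E y z = E y' z" if zV: "z \<in> V - {y, y'}" for z
    proof -
      consider "z \<in> R" | "depth z \<noteq> k" | "z \<in> L" "z \<notin> R" using zV unfolding L_def by blast
      then show ?thesis
      proof cases
        case 1 then show ?thesis using y that by auto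
      next
        case 2 then show ?thesis using NR[of z y y'] NR[of z y' y] y that sym by blast
      next
        case 3
        then show ?thesis using component_closed[of _ L x z] xL y unfolding R_def by blast
      qed
    qed
    then have "removable E V y y' True" using y RV by (auto simp: removable_def)
    then show ?thesis by blast
  next
    case False
    moreover have "card R > 0" using RL finite_subset[OF RV fin] by (auto simp: card_gt_0_iff)
    ultimately have "card R = 1" by linarith
    then have R: "R = {x}" using RL by (auto simp: card_1_singleton_iff)
    have low: "k = Suc (depth z)" if "z \<in> V" "E z x" for z
    proof -
      have "z \<notin> L"
      proof
        assume "z \<in> L"
        then have "z \<in> R"
          using component_closed[OF component_self xL sym[OF that(2)]] by (simp add: R_def)
        then show False using R that irrefl by simp
      qed
      then show ?thesis using that k[of z] depth_edge[of z x] x by (auto simp: L_def)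
    qed
    then have Nx: "N x = {z \<in> V. E z x}" by (auto simp: N_def)
    have nN: "n \<in> N x" using n x by (simp add: N_def)
    show ?thesis
    proof (cases "card (N x) \<ge> 2")
      case True
      have "p4_free E (N x)"
        by (rule p4_free_neighbourhood[of _ x]) (use x sym in \<open>auto simp: N_def\<close>)
      moreover have "finite (N x)" using fin by (simp add: N_def)
      ultimately obtain a b where ab: "a \<in> N x" "b \<in> N x" "a \<noteq> b" "\<forall>z \<in> N x - {a, b}. E a z = E b z"
        using p4_free_twins[of E "N x"] sym_iff True by blast
      have mod: "E z b" if "a \<in> N x" "b \<in> N x" "a \<noteq> b" "z \<in> V" "z \<notin> N x" "z \<noteq> x" "E z a" for a b z
        by (rule deepest_neighbours_module[OF k x low min[unfolded N_def] fin, of a b])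
          (use that Nx in auto)
      have "E a z = E b z" if "z \<in> V - {a, b}" for z
      proof (cases "z \<in> N x \<or> z = x")
        case True
        then show ?thesis using ab that Nx by auto
      next
        case False
        then show ?thesis using mod[of a b z] mod[of b a z] ab that sym by blast
      qed
      then have "removable E V a b True" using ab Nx by (auto simp: removable_def)
      then show ?thesis by blast
    next
      case False
      have "card (N x) > 0" using nN fin by (auto simp: card_gt_0_iff N_def)
      then have "card (N x) = 1" using False by linarith
      then have "N x = {n}" using nN by (auto simp: card_1_singleton_iff)
      then have "removable E V x n False"
        using x n Nx irrefl sym by (auto simp: removable_def)
      then show ?thesis by blast
    qed
  qed
qed

end

subsection \<open>Rooted split decompositions\<close>

text \<open>
  \<open>rooted_decomp E D A\<close> encodes a rooted split decomposition: the root is an external vertex whose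
  neighbourhood in \<open>D\<close> is \<open>A\<close>.  The rules correspond to the three nodes (star centred at the root, clique,
  star centred at a child) that can join the root to two parts.
\<close>

inductive rooted_decomp :: "('a \<Rightarrow> 'a \<Rightarrow> bool) \<Rightarrow> 'a set \<Rightarrow> 'a set \<Rightarrow> bool" for E where
  leaf: "rooted_decomp E {x} {x}"
| union: "rooted_decomp E D1 A1 \<Longrightarrow> rooted_decomp E D2 A2 \<Longrightarrow> D1 \<inter> D2 = {} \<Longrightarrow>
    (\<And>x y. x \<in> D1 \<Longrightarrow> y \<in> D2 \<Longrightarrow> \<not> E x y) \<Longrightarrow> rooted_decomp E (D1 \<union> D2) (A1 \<union> A2)"
| join: "rooted_decomp E D1 A1 \<Longrightarrow> rooted_decomp E D2 A2 \<Longrightarrow> D1 \<inter> D2 = {} \<Longrightarrow>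
    (\<And>x y. x \<in> D1 \<Longrightarrow> y \<in> D2 \<Longrightarrow> E x y \<longleftrightarrow> x \<in> A1 \<and> y \<in> A2) \<Longrightarrow> rooted_decomp E (D1 \<union> D2) (A1 \<union> A2)"
| attach: "rooted_decomp E D1 A1 \<Longrightarrow> rooted_decomp E D2 A2 \<Longrightarrow> D1 \<inter> D2 = {} \<Longrightarrow>
    (\<And>x y. x \<in> D1 \<Longrightarrow> y \<in> D2 \<Longrightarrow> E x y \<longleftrightarrow> x \<in> A1 \<and> y \<in> A2) \<Longrightarrow> rooted_decomp E (D1 \<union> D2) A1"

lemma rooted_decomp_props:
  "rooted_decomp E D A \<Longrightarrow> A \<subseteq> D \<and> A \<noteq> {} \<and> finite D"
  by (induction rule: rooted_decomp.induct) auto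

lemma card_rooted_decomp_Un:
  assumes "rooted_decomp E D1 A1" "rooted_decomp E D2 A2" "D1 \<inter> D2 = {}"
  shows "card D1 < card (D1 \<union> D2)" "card D2 < card (D1 \<union> D2)"
proof -
  have "finite D1" "finite D2" "D1 \<noteq> {}" "D2 \<noteq> {}"
    using assms rooted_decomp_props by fastforce+
  then show "card D1 < card (D1 \<union> D2)" "card D2 < card (D1 \<union> D2)"
    using assms(3) by (auto simp: card_Un_disjoint card_gt_0_iff)
qed

context simple_rel
begin

text \<open>The leaf \<open>v\<close> is replaced by a node with leaves \<open>v\<close> and
  \<open>v'\<close>: \<open>attach\<close> for a pendant vertex, \<open>join\<close> for an adjacent
  twin, \<open>union\<close> for a non-adjacent one. The nodes above it are rebuilt unchanged in
  kind.\<close>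

lemma rooted_decomp_insert:
  assumes "rooted_decomp E D A" "v \<in> D" "v' \<notin> D" "\<not> t \<Longrightarrow> E v' v"
    and "\<And>z. z \<in> D \<Longrightarrow> z \<noteq> v \<Longrightarrow> E v' z \<longleftrightarrow> t \<and> E v z"
  shows "rooted_decomp E (insert v' D) (if t \<and> v \<in> A then insert v' A else A)"
  using assms
proof (induction rule: rooted_decomp.induct)
  case (leaf x)
  then have v: "v = x" by simp
  have l: "rooted_decomp E {x} {x}" "rooted_decomp E {v'} {v'}" "{x} \<inter> {v'} = {}"
    using leaf rooted_decomp.leaf by auto
  consider "\<not> t" | "t" "E v' x" | "t" "\<not> E v' x" by blast
  then show ?case
  proof cases
    case 1
    have "rooted_decomp E ({x} \<union> {v'}) {x}"
      by (rule rooted_decomp.attach[OF l]) (use 1 leaf v sym in auto)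
    then show ?thesis using 1 by (simp add: insert_commute)
  next
    case 2
    have "rooted_decomp E ({x} \<union> {v'}) ({x} \<union> {v'})"
      by (rule rooted_decomp.join[OF l]) (use 2 sym in auto)
    then show ?thesis using 2 v by (simp add: insert_commute)
  next
    case 3
    have "rooted_decomp E ({x} \<union> {v'}) ({x} \<union> {v'})"
      by (rule rooted_decomp.union[OF l]) (use 3 sym in auto)
    then show ?thesis using 3 v by (simp add: insert_commute)
  qed
next
  case (union D1 A1 D2 A2)
  have A: "A1 \<subseteq> D1" "A2 \<subseteq> D2" using union rooted_decomp_props by blast+
  show ?case
  proof (cases "v \<in> D1")
    case True
    have e: "\<not> E v' z" if "z \<in> D2" for z using union True that by blast
    have "rooted_decomp E (insert v' D1 \<union> D2) ((if t \<and> v \<in> A1 then insert v' A1 else A1) \<union> A2)"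
      by (rule rooted_decomp.union) (use union True e in auto)
    moreover have "v \<notin> A2" using True union A by auto
    ultimately show ?thesis by (cases "t \<and> v \<in> A1 \<union> A2") auto
  next
    case False
    then have v: "v \<in> D2" using union by auto
    have e: "\<not> E z v'" if "z \<in> D1" for z
      using union.prems(4)[of z] union.hyps(4)[of z v] v False that sym by blast
    have "rooted_decomp E (D1 \<union> insert v' D2) (A1 \<union> (if t \<and> v \<in> A2 then insert v' A2 else A2))"
      by (rule rooted_decomp.union) (use union v e in auto)
    moreover have "v \<notin> A1" using False A by auto
    ultimately show ?thesis by (cases "t \<and> v \<in> A1 \<union> A2") auto
  qed
next
  case (join D1 A1 D2 A2)
  have A: "A1 \<subseteq> D1" "A2 \<subseteq> D2" using join rooted_decomp_props by blast+
  show ?case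
  proof (cases "v \<in> D1")
    case True
    let ?A = "if t \<and> v \<in> A1 then insert v' A1 else A1"
    have e: "E v' z \<longleftrightarrow> v' \<in> ?A \<and> z \<in> A2" if "z \<in> D2" for z
      using join.prems(4)[of z] join.hyps(4)[of v z] join.hyps(3) join.prems(2) A True that by auto
    have "rooted_decomp E (insert v' D1 \<union> D2) (?A \<union> A2)"
      by (rule rooted_decomp.join) (use join True e in auto)
    moreover have "v \<notin> A2" using True join A by auto
    ultimately show ?thesis by (cases "t \<and> v \<in> A1 \<union> A2") auto
  next
    case False
    then have v: "v \<in> D2" using join by auto
    let ?A = "if t \<and> v \<in> A2 then insert v' A2 else A2"
    have e: "E z v' \<longleftrightarrow> z \<in> A1 \<and> v' \<in> ?A" if "z \<in> D1" for z
      using join.prems(4)[of z] join.hyps(4)[of z v] join.hyps(3) join.prems(2) A v that sym_iff[of z] by auto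
    have "rooted_decomp E (D1 \<union> insert v' D2) (A1 \<union> ?A)"
      by (rule rooted_decomp.join) (use join v e in auto)
    moreover have "v \<notin> A1" using False A by auto
    ultimately show ?thesis by (cases "t \<and> v \<in> A1 \<union> A2") auto
  qed
next
  case (attach D1 A1 D2 A2)
  have A: "A1 \<subseteq> D1" "A2 \<subseteq> D2" using attach rooted_decomp_props by blast+
  show ?case
  proof (cases "v \<in> D1")
    case True
    let ?A = "if t \<and> v \<in> A1 then insert v' A1 else A1"
    have e: "E v' z \<longleftrightarrow> v' \<in> ?A \<and> z \<in> A2" if "z \<in> D2" for z
      using attach.prems(4)[of z] attach.hyps(4)[of v z] attach.hyps(3) attach.prems(2) A True that by auto
    have "rooted_decomp E (insert v' D1 \<union> D2) ?A"
      by (rule rooted_decomp.attach) (use attach True e in auto)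
    then show ?thesis by simp
  next
    case False
    then have v: "v \<in> D2" using attach by auto
    let ?A = "if t \<and> v \<in> A2 then insert v' A2 else A2"
    have e: "E z v' \<longleftrightarrow> z \<in> A1 \<and> v' \<in> ?A" if "z \<in> D1" for z
      using attach.prems(4)[of z] attach.hyps(4)[of z v] attach.hyps(3) attach.prems(2) A v that sym_iff[of z] by auto
    have "rooted_decomp E (D1 \<union> insert v' D2) A1"
      by (rule rooted_decomp.attach) (use attach v e in \<open>auto split: if_splits\<close>)
    moreover have "v \<notin> A1" using False A by auto
    ultimately show ?thesis by simp
  qed
qed

text \<open>The map \<open>f\<close> that sends \<open>x\<close> to \<open>y\<close> and fixes the
  rest takes every edge to an edge or to a single vertex, so it carries walks to walks that avoid
  \<open>x\<close>.\<close>

lemma connected_in_remove: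
  assumes rem: "removable E V x y t" and conn: "connected_in E V"
  shows "connected_in E (V - {x})"
proof -
  define f where "f z = (if z = x then y else z)" for z
  have step: "(f b, f c) \<in> (arcs_in E (V - {x}))\<^sup>*" if "(b, c) \<in> arcs_in E V" for b c
  proof (cases "f b = f c")
    case False
    have bc: "E b c" "E c b" "b \<in> V" "c \<in> V" using that sym by (auto simp: arcs_in_def)
    have "E (f b) (f c)"
    proof (cases "b = x \<or> c = x")
      case True
      then show ?thesis
        using bc False rem irrefl sym unfolding removable_def f_def by (auto split: if_splits)
    next
      case False
      then show ?thesis using bc by (simp add: f_def)
    qed
    moreover have "f b \<in> V - {x}" "f c \<in> V - {x}" using bc rem by (auto simp: f_def removable_def)
    ultimately show ?thesis by (auto simp: arcs_in_def)
  qed simp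
  have walk: "(f a, f b) \<in> (arcs_in E (V - {x}))\<^sup>*" if "(a, b) \<in> (arcs_in E V)\<^sup>*" for a b
    using that by induction (auto intro: rtrancl_trans step)
  show ?thesis
    unfolding connected_in_def
  proof (intro ballI)
    fix a b assume ab: "a \<in> V - {x}" "b \<in> V - {x}"
    then have "(a, b) \<in> (arcs_in E V)\<^sup>*" using conn by (auto simp: connected_in_def)
    from walk[OF this] show "(a, b) \<in> (arcs_in E (V - {x}))\<^sup>*" using ab by (simp add: f_def)
  qed
qed

text \<open>Induction by deleting a removable vertex. The only delicate cases are those in which the
  root itself is one of the two vertices involved; they add a node at the top.\<close>

lemma dist_hered_rooted_decomp:
  "finite V \<Longrightarrow> card V \<ge> 2 \<Longrightarrow> connected_in E V \<Longrightarrow> dist_hered E V \<Longrightarrow> r \<in> V \<Longrightarrow>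
    rooted_decomp E (V - {r}) {y \<in> V. E r y}"
proof (induction "card V" arbitrary: V r rule: less_induct)
  case less
  show ?case
  proof (cases "card V = 2")
    case True
    then have "card (V - {r}) = 1" using less.prems by simp
    then obtain w where w: "V - {r} = {w}" by (rule card_1_singletonE)
    then have V: "V = {r, w}" "w \<noteq> r" using less.prems by auto
    then have "(r, w) \<in> (arcs_in E V)\<^sup>*" using less.prems(3) by (auto simp: connected_in_def)
    then obtain z where "(r, z) \<in> arcs_in E V" using V by (auto elim: converse_rtranclE)
    then have "E r w" using V irrefl by (auto simp: arcs_in_def)
    then have "{y \<in> V. E r y} = {w}" using V irrefl by auto
    then show ?thesis using w rooted_decomp.leaf by simp
  next
    case False
    then have card: "card V \<ge> 3" using less.prems by simp
    interpret rooted_dist_hered E V r by unfold_locales (use less.prems in auto)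
    have IH: "rooted_decomp E (V - {x} - {r'}) {y \<in> V - {x}. E r' y}"
      if "removable E V x y t" "r' \<in> V - {x}" for x y t r'
    proof (rule less.hyps)
      show "dist_hered E (V - {x})" using dist_hered_subset less.prems by blast
      show "connected_in E (V - {x})" using connected_in_remove that less.prems by blast
    qed (use that less.prems card in \<open>auto simp: removable_def intro: psubset_card_mono\<close>)
    have root: ?thesis if rem: "removable E V x r t" for x t
    proof -
      let ?D = "V - {x} - {r}" and ?A = "{y \<in> V - {x}. E r y}"
      have dec: "rooted_decomp E ?D ?A" "rooted_decomp E {x} {x}" "?D \<inter> {x} = {}"
        using IH[OF rem, of r] rem rooted_decomp.leaf[of E x] less.prems(5) by (auto simp: removable_def)
      have D: "?D \<union> {x} = V - {r}" and x: "x \<in> V" "x \<noteq> r" using rem by (auto simp: removable_def)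
      have e: "E z x \<longleftrightarrow> t \<and> E r z" if "z \<in> ?D" for z
        using rem that sym by (auto simp: removable_def)
      \<comment> \<open>A vertex pendant at \<open>r\<close> gives a \<open>union\<close> node, an
        adjacent twin of \<open>r\<close> a \<open>join\<close> node, and a non-adjacent twin an
        \<open>attach\<close> node, because it sees the neighbours of \<open>r\<close> but not
        \<open>r\<close>.\<close>
      consider "\<not> t" "E r x" | t "E r x" | t "\<not> E r x" using rem sym by (auto simp: removable_def)
      then show ?thesis
      proof cases
        case 1
        have "rooted_decomp E (?D \<union> {x}) (?A \<union> {x})"
          by (rule rooted_decomp.union[OF dec]) (use e 1 in auto)
        moreover have "?A \<union> {x} = {y \<in> V. E r y}" using 1 x by auto
        ultimately show ?thesis by (simp only: D)
      next
        case 2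
        have "rooted_decomp E (?D \<union> {x}) (?A \<union> {x})"
          by (rule rooted_decomp.join[OF dec]) (use e 2 in auto)
        moreover have "?A \<union> {x} = {y \<in> V. E r y}" using 2 x by auto
        ultimately show ?thesis by (simp only: D)
      next
        case 3
        have "rooted_decomp E (?D \<union> {x}) ?A"
          by (rule rooted_decomp.attach[OF dec]) (use e 3 in auto)
        moreover have "?A = {y \<in> V. E r y}" using 3 x by auto
        ultimately show ?thesis by (simp only: D)
      qed
    qed
    obtain x y t where rem: "removable E V x y t" using ex_removable less.prems by blast
    then have xy: "x \<in> V" "y \<in> V" "x \<noteq> y" by (auto simp: removable_def)
    consider "y = r" | "x = r" t | "x = r" "\<not> t" | "x \<noteq> r" "y \<noteq> r" by blast
    then show ?thesis
    proof cases
      case 1 then show ?thesis using root rem by blast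
    next
      case 2
      then have "removable E V y r True" using rem by (auto simp: removable_def)
      then show ?thesis using root by blast
    next
      case 3
      \<comment> \<open>Here the root is pendant at \<open>y\<close>. The remaining graph is
        decomposed with root \<open>y\<close> instead, and \<open>y\<close> then becomes the centre
        of a top star.\<close>
      let ?D = "V - {x} - {y}" and ?A = "{z \<in> V - {x}. E y z}"
      have dec: "rooted_decomp E {y} {y}" "rooted_decomp E ?D ?A" "{y} \<inter> ?D = {}"
        using IH[OF rem, of y] xy rooted_decomp.leaf by auto
      have "rooted_decomp E ({y} \<union> ?D) {y}"
        by (rule rooted_decomp.attach[OF dec]) auto
      moreover have "{y} \<union> ?D = V - {r}" "{z \<in> V. E r z} = {y}"
        using xy 3 rem irrefl by (auto simp: removable_def)
      ultimately show ?thesis by simp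
    next
      case 4
      let ?D = "V - {x} - {r}" and ?A = "{y \<in> V - {x}. E r y}"
      have "rooted_decomp E (insert x ?D) (if t \<and> y \<in> ?A then insert x ?A else ?A)"
        by (rule rooted_decomp_insert)
          (use IH[OF rem, of r] 4 xy rem less.prems in \<open>auto simp: removable_def\<close>)
      moreover have "insert x ?D = V - {r}" using 4 xy by auto
      moreover have "E r x \<longleftrightarrow> t \<and> E r y"
        using rem 4 less.prems sym_iff[of r] by (auto simp: removable_def)
      then have "(if t \<and> y \<in> ?A then insert x ?A else ?A) = {y \<in> V. E r y}" using xy by auto
      ultimately show ?thesis by (simp only:)
    qed
  qed
qed

end

subsection \<open>Rank bounds for orderings\<close>

text \<open>Rank as the number of outer products needed, so that rank-one corrections and repeated
  rows or columns can be handled without linear algebra.\<close>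

definition rank_le :: "('r \<Rightarrow> 'c \<Rightarrow> bit) \<Rightarrow> 'r set \<Rightarrow> 'c set \<Rightarrow> nat \<Rightarrow> bool" where
  "rank_le M X Y k \<longleftrightarrow> (\<exists>f g. \<forall>x \<in> X. \<forall>y \<in> Y. M x y = (\<Sum>i<k. f i x * g i y))"

lemma rank_le_Suc:
  assumes "rank_le M' X Y k" "\<And>x y. x \<in> X \<Longrightarrow> y \<in> Y \<Longrightarrow> M x y = M' x y + p x * q y"
  shows "rank_le M X Y (Suc k)"
proof -
  obtain f g where fg: "\<forall>x \<in> X. \<forall>y \<in> Y. M' x y = (\<Sum>i<k. f i x * g i y)"
    using assms(1) unfolding rank_le_def by blast
  show ?thesis
    unfolding rank_le_def
    by (rule exI[of _ "\<lambda>i. if i < k then f i else p"], rule exI[of _ "\<lambda>i. if i < k then g i else q"])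
      (simp add: assms(2) fg)
qed

lemma rank_le_mono: "rank_le M X Y k \<Longrightarrow> k \<le> l \<Longrightarrow> rank_le M X Y l"
proof (induction l)
  case (Suc l)
  then show ?case using rank_le_Suc[of M X Y l M "\<lambda>_. 0" "\<lambda>_. 0"] by (cases "k = Suc l") auto
qed simp

lemma rank_le_1: "(\<And>x y. x \<in> X \<Longrightarrow> y \<in> Y \<Longrightarrow> M x y = p x * q y) \<Longrightarrow> rank_le M X Y 1"
  unfolding rank_le_def by (rule exI[of _ "\<lambda>_. p"], rule exI[of _ "\<lambda>_. q"]) simp

lemma rank_le_map:
  assumes "rank_le M X Y k" "\<And>x. x \<in> X' \<Longrightarrow> P x \<Longrightarrow> \<phi> x \<in> X" "\<And>y. y \<in> Y' \<Longrightarrow> Q y \<Longrightarrow> \<psi> y \<in> Y"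
    and "\<And>x y. x \<in> X' \<Longrightarrow> y \<in> Y' \<Longrightarrow> M' x y = (if P x \<and> Q y then M (\<phi> x) (\<psi> y) else 0)"
  shows "rank_le M' X' Y' k"
proof -
  obtain f g where fg: "\<forall>x \<in> X. \<forall>y \<in> Y. M x y = (\<Sum>i<k. f i x * g i y)"
    using assms(1) unfolding rank_le_def by blast
  show ?thesis
    unfolding rank_le_def
    by (rule exI[of _ "\<lambda>i x. if P x then f i (\<phi> x) else 0"],
        rule exI[of _ "\<lambda>i y. if Q y then g i (\<psi> y) else 0"])
      (auto simp: assms fg)
qed

lemma rank_le_map_plus_2:
  assumes "rank_le M X Y k" "\<And>x. x \<in> X' \<Longrightarrow> P x \<Longrightarrow> \<phi> x \<in> X" "\<And>y. y \<in> Y' \<Longrightarrow> Q y \<Longrightarrow> \<psi> y \<in> Y"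
    and "\<And>x y. x \<in> X' \<Longrightarrow> y \<in> Y' \<Longrightarrow>
      M' x y = (if P x \<and> Q y then M (\<phi> x) (\<psi> y) else 0) + p x * q y + p' x * q' y"
  shows "rank_le M' X' Y' (k + 2)"
proof -
  let ?M = "\<lambda>x y. if P x \<and> Q y then M (\<phi> x) (\<psi> y) else 0"
  have "rank_le ?M X' Y' k" by (rule rank_le_map[OF assms(1-3)]) auto
  then have "rank_le (\<lambda>x y. ?M x y + p x * q y) X' Y' (Suc k)" by (rule rank_le_Suc) auto
  then have "rank_le M' X' Y' (Suc (Suc k))" by (rule rank_le_Suc) (auto simp: assms(4))
  then show ?thesis by simp
qed

text \<open>The \<open>k\<close> functions \<open>g i\<close>, cut off outside \<open>Y\<close>,
  span all rows.\<close>

lemma submatrix_rank_le: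
  assumes "rank_le M X Y k" shows "submatrix_rank M X Y \<le> k"
proof -
  interpret V: vector_space "bit_scale :: bit \<Rightarrow> ('b \<Rightarrow> bit) \<Rightarrow> 'b \<Rightarrow> bit"
    by (rule vector_space_bit_scale)
  obtain f g where fg: "\<forall>x \<in> X. \<forall>y \<in> Y. M x y = (\<Sum>i<k. f i x * g i y)"
    using assms unfolding rank_le_def by blast
  let ?g = "\<lambda>i y. if y \<in> Y then g i y else 0"
  have "(\<lambda>y. if y \<in> Y then M x y else 0) \<in> V.span (?g ` {..<k})" if "x \<in> X" for x
  proof -
    have "(\<lambda>y. if y \<in> Y then M x y else 0) = (\<Sum>i<k. bit_scale (f i x) (?g i))"
    proof -
      have "(\<Sum>i<k. bit_scale (f i x) (?g i)) y = (\<Sum>i<k. f i x * ?g i y)" for y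
        by (induction k) auto
      then show ?thesis using fg that by (auto simp: fun_eq_iff)
    qed
    also have "\<dots> \<in> V.span (?g ` {..<k})"
      by (intro V.span_sum V.span_scale V.span_base) auto
    finally show ?thesis .
  qed
  then have "(\<lambda>x y. if y \<in> Y then M x y else 0) ` X \<subseteq> V.span (?g ` {..<k})" by auto
  then have "V.dim ((\<lambda>x y. if y \<in> Y then M x y else 0) ` X) \<le> card (?g ` {..<k})"
    by (rule V.dim_le_card) simp
  also have "\<dots> \<le> k" using card_image_le[of "{..<k}" ?g] by simp
  finally show ?thesis unfolding submatrix_rank_def .
qed

section \<open>Cut-ranks along an ordering, without and with a root\<close>

definition cut_width_le :: "('a \<Rightarrow> 'a \<Rightarrow> bool) \<Rightarrow> 'a list \<Rightarrow> nat \<Rightarrow> bool" where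
  "cut_width_le E xs k \<longleftrightarrow>
     (\<forall>us vs. xs = us @ vs \<longrightarrow> rank_le (\<lambda>x y. of_bool (E x y)) (set us) (set vs) k)"

text \<open>\<open>None\<close> stands for two adjacent copies of a root with neighbourhood \<open>A\<close>, placed before and after the ordering.\<close>

fun bordered :: "('a \<Rightarrow> 'a \<Rightarrow> bool) \<Rightarrow> 'a set \<Rightarrow> 'a option \<Rightarrow> 'a option \<Rightarrow> bit" where
  "bordered E A (Some x) (Some y) = of_bool (E x y)"
| "bordered E A (Some x) None = of_bool (x \<in> A)"
| "bordered E A None (Some y) = of_bool (y \<in> A)"
| "bordered E A None None = 1"

definition bordered_width_le :: "('a \<Rightarrow> 'a \<Rightarrow> bool) \<Rightarrow> 'a set \<Rightarrow> 'a list \<Rightarrow> nat \<Rightarrow> bool" where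
  "bordered_width_le E A xs k \<longleftrightarrow> (\<forall>us vs. xs = us @ vs \<longrightarrow>
     rank_le (bordered E A) (insert None (Some ` set us)) (insert None (Some ` set vs)) k)"

lemma cut_width_le_mono: "cut_width_le E xs k \<Longrightarrow> k \<le> l \<Longrightarrow> cut_width_le E xs l"
  unfolding cut_width_le_def by (blast intro: rank_le_mono)

lemma bordered_width_le_mono: "bordered_width_le E A xs k \<Longrightarrow> k \<le> l \<Longrightarrow> bordered_width_le E A xs l"
  unfolding bordered_width_le_def by (blast intro: rank_le_mono)

lemma cut_width_le_if_bordered:
  assumes "bordered_width_le E A xs k" shows "cut_width_le E xs k"
  unfolding cut_width_le_def
proof (intro allI impI)
  fix us vs assume "xs = us @ vs"
  then have "rank_le (bordered E A) (insert None (Some ` set us)) (insert None (Some ` set vs)) k"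
    using assms unfolding bordered_width_le_def by blast
  then show "rank_le (\<lambda>x y. of_bool (E x y)) (set us) (set vs) k"
    by (rule rank_le_map[where \<phi> = Some and \<psi> = Some and P = "\<lambda>_. True" and Q = "\<lambda>_. True"]) auto
qed

text \<open>The row of \<open>r\<close> is the row \<open>None\<close>; the column
  \<open>None\<close> is dropped.\<close>

lemma cut_width_le_Cons:
  assumes bw: "bordered_width_le E A xs k" and A: "\<And>x. x \<in> set xs \<Longrightarrow> E r x \<longleftrightarrow> x \<in> A"
  shows "cut_width_le E (r # xs) k"
  unfolding cut_width_le_def
proof (intro allI impI)
  fix us vs assume eq: "r # xs = us @ vs"
  show "rank_le (\<lambda>x y. of_bool (E x y)) (set us) (set vs) k"
  proof (cases us)
    case Nil
    then show ?thesis by (simp add: rank_le_def)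
  next
    case (Cons a us')
    then have us: "us = r # us'" "xs = us' @ vs" using eq by auto
    then have "rank_le (bordered E A) (insert None (Some ` set us')) (insert None (Some ` set vs)) k"
      using bw unfolding bordered_width_le_def by blast
    then show ?thesis
      by (rule rank_le_map[where \<phi> = "\<lambda>x. if x \<in> set us' then Some x else None" and \<psi> = Some
            and P = "\<lambda>_. True" and Q = "\<lambda>_. True"]) (use us A in auto)
  qed
qed

lemma cut_width_le_append:
  assumes "cut_width_le E xs k" "cut_width_le E ys k"
    and no: "\<And>x y. x \<in> set xs \<Longrightarrow> y \<in> set ys \<Longrightarrow> \<not> E x y"
  shows "cut_width_le E (xs @ ys) k"
  unfolding cut_width_le_def
proof (intro allI impI)
  fix us vs assume "xs @ ys = us @ vs"
  then consider t where "xs = us @ t" "vs = t @ ys" | t where "us = xs @ t" "ys = t @ vs"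
    by (auto simp: append_eq_append_conv2)
  then show "rank_le (\<lambda>x y. of_bool (E x y)) (set us) (set vs) k"
  proof cases
    case 1
    then have "rank_le (\<lambda>x y. of_bool (E x y)) (set us) (set t) k"
      using assms unfolding cut_width_le_def by blast
    then show ?thesis
      by (rule rank_le_map[where \<phi> = id and \<psi> = id and P = "\<lambda>_. True" and Q = "\<lambda>y. y \<in> set t"])
        (use 1 no in auto)
  next
    case 2
    then have "rank_le (\<lambda>x y. of_bool (E x y)) (set t) (set vs) k"
      using assms unfolding cut_width_le_def by blast
    then show ?thesis
      by (rule rank_le_map[where \<phi> = id and \<psi> = id and P = "\<lambda>x. x \<in> set t" and Q = "\<lambda>_. True"])
        (use 2 no in auto)
  qed
qed

text \<open>Both cuts give a matrix of ones. This is the summand 1 in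
  \<open>2 * s + 1\<close>.\<close>

lemma bordered_width_le_leaf: "bordered_width_le E {x} [x] 1"
  unfolding bordered_width_le_def
proof (intro allI impI)
  fix us vs assume "[x] = us @ vs"
  then consider "us = []" | "us = [x]" "vs = []" by (cases us) auto
  then show "rank_le (bordered E {x}) (insert None (Some ` set us)) (insert None (Some ` set vs)) 1"
  proof cases
    case 1
    show ?thesis
      by (rule rank_le_1[where p = "\<lambda>_. 1" and q = "bordered E {x} None"]) (use 1 in auto)
  next
    case 2
    show ?thesis
      by (rule rank_le_1[where p = "\<lambda>r. bordered E {x} r None" and q = "\<lambda>_. 1"]) (use 2 in auto)
  qed
qed

text \<open>For a cut inside \<open>xs\<close>, the columns of \<open>A2\<close> repeat the column
  \<open>None\<close> and the other columns of \<open>ys\<close> vanish, so the rank does not grow;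
  dually for a cut inside \<open>ys\<close>. The entry 1 at \<open>None\<close>, \<open>None\<close>
  is what makes the row of the root fit as well.\<close>

lemma bordered_width_le_join:
  assumes "bordered_width_le E A1 xs k" "bordered_width_le E A2 ys k"
    and disj: "set xs \<inter> set ys = {}" and A: "A1 \<subseteq> set xs" "A2 \<subseteq> set ys"
    and e: "\<And>x y. x \<in> set xs \<Longrightarrow> y \<in> set ys \<Longrightarrow> E x y \<longleftrightarrow> x \<in> A1 \<and> y \<in> A2"
  shows "bordered_width_le E (A1 \<union> A2) (xs @ ys) k"
  unfolding bordered_width_le_def
proof (intro allI impI)
  fix us vs assume "xs @ ys = us @ vs"
  then consider t where "xs = us @ t" "vs = t @ ys" | t where "us = xs @ t" "ys = t @ vs"
    by (auto simp: append_eq_append_conv2)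
  then show "rank_le (bordered E (A1 \<union> A2)) (insert None (Some ` set us)) (insert None (Some ` set vs)) k"
  proof cases
    case 1
    then have "rank_le (bordered E A1) (insert None (Some ` set us)) (insert None (Some ` set t)) k"
      using assms unfolding bordered_width_le_def by blast
    then show ?thesis
      by (rule rank_le_map[where \<phi> = id and \<psi> = "\<lambda>y. if y \<in> Some ` set t then y else None"
            and P = "\<lambda>_. True" and Q = "\<lambda>y. y \<notin> Some ` (set ys - A2)"])
        (use 1 disj A e in auto)
  next
    case 2
    then have "rank_le (bordered E A2) (insert None (Some ` set t)) (insert None (Some ` set vs)) k"
      using assms unfolding bordered_width_le_def by blast
    then show ?thesis
      by (rule rank_le_map[where \<psi> = id and \<phi> = "\<lambda>x. if x \<in> Some ` set t then x else None"
            and Q = "\<lambda>_. True" and P = "\<lambda>x. x \<notin> Some ` (set xs - A1)"])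
        (use 2 disj A e in auto)
  qed
qed

text \<open>Beyond the unbordered matrix there is one new row and one new column, hence two new
  rank-one terms.\<close>

lemma bordered_width_le_union:
  assumes "cut_width_le E xs k" "cut_width_le E ys k"
    and no: "\<And>x y. x \<in> set xs \<Longrightarrow> y \<in> set ys \<Longrightarrow> \<not> E x y"
  shows "bordered_width_le E A (xs @ ys) (k + 2)"
  unfolding bordered_width_le_def
proof (intro allI impI)
  fix us vs assume "xs @ ys = us @ vs"
  then have "rank_le (\<lambda>x y. of_bool (E x y)) (set us) (set vs) k"
    using cut_width_le_append[OF assms] unfolding cut_width_le_def by blast
  then show "rank_le (bordered E A) (insert None (Some ` set us)) (insert None (Some ` set vs)) (k + 2)"
    by (rule rank_le_map_plus_2[where \<phi> = the and \<psi> = the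
          and P = "\<lambda>x. x \<noteq> None" and Q = "\<lambda>y. y \<noteq> None"
          and p = "\<lambda>x. of_bool (x = None)" and q = "bordered E A None"
          and p' = "\<lambda>x. of_bool (x \<in> Some ` A)" and q' = "\<lambda>y. of_bool (y = None)"]) auto
qed

text \<open>The root and the vertices of \<open>A2\<close> have the same neighbours in
  \<open>D1\<close>-side vertices, namely \<open>A1\<close>, so one rank-one term serves all of
  them. The second term is the column of the root.\<close>

lemma bordered_width_le_attach:
  assumes "cut_width_le E xs k" "cut_width_le E ys k" and sym: "\<And>x y. E x y \<Longrightarrow> E y x"
    and disj: "set xs \<inter> set ys = {}" and A: "A1 \<subseteq> set xs" "A2 \<subseteq> set ys"
    and e: "\<And>x y. x \<in> set xs \<Longrightarrow> y \<in> set ys \<Longrightarrow> E x y \<longleftrightarrow> x \<in> A1 \<and> y \<in> A2"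
  shows "bordered_width_le E A1 (ys @ xs) (k + 2)"
  unfolding bordered_width_le_def
proof (intro allI impI)
  have e': "E y x \<longleftrightarrow> x \<in> A1 \<and> y \<in> A2" if "x \<in> set xs" "y \<in> set ys" for x y
    using e[OF that] sym by blast
  fix us vs assume "ys @ xs = us @ vs"
  then consider t where "ys = us @ t" "vs = t @ xs" | t where "us = ys @ t" "xs = t @ vs"
    by (auto simp: append_eq_append_conv2)
  then show "rank_le (bordered E A1) (insert None (Some ` set us)) (insert None (Some ` set vs)) (k + 2)"
  proof cases
    case 1
    then have "rank_le (\<lambda>x y. of_bool (E x y)) (set us) (set t) k"
      using assms unfolding cut_width_le_def by blast
    then show ?thesis
      by (rule rank_le_map_plus_2[where \<phi> = the and \<psi> = the
            and P = "\<lambda>x. x \<noteq> None" and Q = "\<lambda>y. y \<in> Some ` set t"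
            and p = "\<lambda>x. of_bool (x \<in> insert None (Some ` A2))" and q = "\<lambda>y. of_bool (y \<in> Some ` A1)"
            and p' = "\<lambda>x. of_bool (x = None)" and q' = "\<lambda>y. of_bool (y = None)"])
        (use 1 disj A e' in auto)
  next
    case 2
    then have "rank_le (\<lambda>x y. of_bool (E x y)) (set t) (set vs) k"
      using assms unfolding cut_width_le_def by blast
    then show ?thesis
      by (rule rank_le_map_plus_2[where \<phi> = the and \<psi> = the
            and P = "\<lambda>x. x \<in> Some ` set t" and Q = "\<lambda>y. y \<noteq> None"
            and p = "\<lambda>x. of_bool (x \<in> insert None (Some ` A2))" and q = "\<lambda>y. of_bool (y \<in> Some ` A1)"
            and p' = "\<lambda>x. of_bool (x \<in> insert None (Some ` A1))" and q' = "\<lambda>y. of_bool (y = None)"])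
        (use 2 disj A e' in auto)
  qed
qed

subsection \<open>Induced paths obtained by pivoting\<close>

definition loc_compl :: "('a \<Rightarrow> 'a \<Rightarrow> bool) \<Rightarrow> 'a \<Rightarrow> 'a \<Rightarrow> 'a \<Rightarrow> bool" where
  "loc_compl E w a b \<longleftrightarrow> (E a b \<noteq> (E w a \<and> E w b \<and> a \<noteq> b))"

definition piv :: "('a \<Rightarrow> 'a \<Rightarrow> bool) \<Rightarrow> 'a \<Rightarrow> 'a \<Rightarrow> 'a \<Rightarrow> 'a \<Rightarrow> bool" where
  "piv E u v = loc_compl (loc_compl (loc_compl E u) v) u"

context simple_rel
begin

lemma simple_rel_loc_compl: "simple_rel (loc_compl E w)"
  by unfold_locales (auto simp: loc_compl_def irrefl sym_iff)

end

lemma (in simple_rel) simple_rel_piv: "simple_rel (piv E u v)"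
  unfolding piv_def by (intro simple_rel.simple_rel_loc_compl simple_rel_axioms)

context simple_rel
begin

lemma piv_edge:
  assumes "E u v" shows "piv E u v u v" "piv E u v v u"
  using assms sym[OF assms] irrefl by (auto simp: piv_def loc_compl_def)

lemma piv_first:
  assumes "E u v" "b \<noteq> u" "b \<noteq> v" shows "piv E u v u b \<longleftrightarrow> E v b" "piv E u v b u \<longleftrightarrow> E v b"
  using assms sym[OF assms(1)] irrefl sym_iff[of b] by (auto simp: piv_def loc_compl_def)

lemma piv_second:
  assumes "E u v" "b \<noteq> u" "b \<noteq> v" shows "piv E u v v b \<longleftrightarrow> E u b" "piv E u v b v \<longleftrightarrow> E u b"
  using assms sym[OF assms(1)] irrefl sym_iff[of b] by (auto simp: piv_def loc_compl_def)

text \<open>The usual description of a pivot: besides exchanging the neighbourhoods of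
  \<open>u\<close> and \<open>v\<close>, it toggles the pairs from different classes among
  "neighbour of \<open>u\<close> only", "of \<open>v\<close> only" and "of both".\<close>

lemma piv_other:
  assumes "E u v" "a \<noteq> u" "a \<noteq> v" "b \<noteq> u" "b \<noteq> v"
  shows "piv E u v a b \<longleftrightarrow> (E a b \<noteq> ((E u a \<and> E v b) \<noteq> (E v a \<and> E u b)))"
  using assms sym[OF assms(1)] irrefl sym_iff[of a u] sym_iff[of a v] sym_iff[of b u] sym_iff[of b v]
  by (cases "a = b") (auto simp: piv_def loc_compl_def)

end

definition induced_path :: "('a \<Rightarrow> 'a \<Rightarrow> bool) \<Rightarrow> 'a list \<Rightarrow> bool" where
  "induced_path E p \<longleftrightarrow> distinct p \<and>
     (\<forall>i < length p. \<forall>j < length p. E (p ! i) (p ! j) \<longleftrightarrow> j = Suc i \<or> i = Suc j)"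

text \<open>The root \<open>r\<close> is never pivoted, so vertices adjacent only to \<open>r\<close> can be added freely.\<close>

inductive path_minor :: "'a set \<Rightarrow> 'a \<Rightarrow> nat \<Rightarrow> ('a \<Rightarrow> 'a \<Rightarrow> bool) \<Rightarrow> bool" for W r m where
  path: "induced_path E (r # p) \<Longrightarrow> set (r # p) \<subseteq> W \<Longrightarrow> m \<le> length (r # p) \<Longrightarrow> path_minor W r m E"
| pivot: "E u v \<Longrightarrow> u \<in> W \<Longrightarrow> v \<in> W \<Longrightarrow> u \<noteq> r \<Longrightarrow> v \<noteq> r \<Longrightarrow> path_minor W r m (piv E u v) \<Longrightarrow>
    path_minor W r m E"

lemma path_minor_mono: "path_minor W r m E \<Longrightarrow> W \<subseteq> W' \<Longrightarrow> m' \<le> m \<Longrightarrow> path_minor W' r m' E"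
proof (induction rule: path_minor.induct)
  case (path E p)
  then show ?case by (intro path_minor.path[of E r p]) auto
next
  case (pivot E u v)
  then show ?case by (intro path_minor.pivot[of E u v]) auto
qed

lemma induced_path_Cons:
  assumes "induced_path E (x # p)" "simple_rel E" "r \<notin> set (x # p)" "E r x" "\<And>y. y \<in> set p \<Longrightarrow> \<not> E r y"
  shows "induced_path E (r # x # p)"
proof -
  interpret simple_rel E by fact
  have xp: "distinct (x # p)" "E ((x # p) ! i) ((x # p) ! j) \<longleftrightarrow> j = Suc i \<or> i = Suc j"
    if "i < length (x # p)" "j < length (x # p)" for i j
    using assms(1) that unfolding induced_path_def by auto
  have r: "E r ((x # p) ! i) \<longleftrightarrow> i = 0" "E ((x # p) ! i) r \<longleftrightarrow> i = 0" if "i < length (x # p)" for i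
    using assms(4,5) that sym_iff[of _ r] by (cases i; auto)+
  have "E ((r # x # p) ! i) ((r # x # p) ! j) \<longleftrightarrow> j = Suc i \<or> i = Suc j"
    if "i < length (r # x # p)" "j < length (r # x # p)" for i j
    using that xp(2)[of "i - 1" "j - 1"] r[of "i - 1"] r[of "j - 1"] irrefl
    by (cases i; cases j) auto
  then show ?thesis using xp(1)[of 0 0] assms(3) unfolding induced_path_def by auto
qed

text \<open>No pivot uses \<open>x\<close> or a neighbour of \<open>r\<close>, so every pivot keeps
  \<open>x\<close> as the only neighbour of \<open>r\<close> in \<open>W\<close>.\<close>

lemma path_minor_pendant:
  "path_minor W x m E \<Longrightarrow> simple_rel E \<Longrightarrow> r \<notin> W \<Longrightarrow> E r x \<Longrightarrow> (\<And>y. y \<in> W \<Longrightarrow> y \<noteq> x \<Longrightarrow> \<not> E r y) \<Longrightarrow>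
    path_minor (insert r W) r (m + 1) E"
proof (induction rule: path_minor.induct)
  case (path E p)
  have "induced_path E (r # x # p)"
    by (rule induced_path_Cons) (use path in \<open>auto simp: induced_path_def\<close>)
  then show ?case using path.hyps by (intro path_minor.path[of E r "x # p"]) auto
next
  case (pivot E u v)
  interpret simple_rel E using pivot.prems by simp
  have ur: "\<not> E u r" "\<not> E v r" "u \<noteq> r" "v \<noteq> r" using pivot sym by blast+
  have "path_minor (insert r W) r (m + 1) (piv E u v)"
  proof (rule pivot.IH)
    show "piv E u v r x"
      using piv_other[of u v r x] pivot ur by auto
    show "\<not> piv E u v r y" if "y \<in> W" "y \<noteq> x" for y
      using piv_other[of u v r y] piv_first[of u v r] piv_second[of u v r] pivot ur that
      by (cases "y = u"; cases "y = v") auto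
  qed (use simple_rel_piv pivot.prems in auto)
  then show ?case using pivot ur by (intro path_minor.pivot[of E u v]) auto
qed

text \<open>\<open>E'\<close> is any graph containing the part \<open>D\<close>, typically one obtained by pivots that left \<open>D\<close> unchanged.\<close>

definition root_of :: "('a \<Rightarrow> 'a \<Rightarrow> bool) \<Rightarrow> 'a set \<Rightarrow> 'a set \<Rightarrow> ('a \<Rightarrow> 'a \<Rightarrow> bool) \<Rightarrow> 'a \<Rightarrow> bool" where
  "root_of E D A E' r \<longleftrightarrow> simple_rel E' \<and> r \<notin> D \<and> (\<forall>x \<in> D. \<forall>y \<in> D. E' x y = E x y) \<and>
     (\<forall>y \<in> D. E' r y \<longleftrightarrow> y \<in> A)"

text \<open>Quantifying over \<open>E'\<close> and \<open>r\<close> lets any vertex with the right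
  neighbourhood play the root, in particular a vertex of a sibling part after a pivot.\<close>

definition has_path :: "('a \<Rightarrow> 'a \<Rightarrow> bool) \<Rightarrow> 'a set \<Rightarrow> 'a set \<Rightarrow> nat \<Rightarrow> bool" where
  "has_path E D A s \<longleftrightarrow> (\<forall>E' r. root_of E D A E' r \<longrightarrow> path_minor (insert r D) r (s + 2) E')"

text \<open>
  A star centred at the root can only be re-centred by pivoting an edge at the root, which is not allowed.
  An adjacent twin \<open>h\<close> of the root can be pivoted instead.
\<close>

definition has_path_twin :: "('a \<Rightarrow> 'a \<Rightarrow> bool) \<Rightarrow> 'a set \<Rightarrow> 'a set \<Rightarrow> nat \<Rightarrow> bool" where
  "has_path_twin E D A s \<longleftrightarrow> (\<forall>E' r h. root_of E D A E' r \<and> root_of E D A E' h \<and> E' r h \<longrightarrow>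
     path_minor (insert h (insert r D)) r (s + 2) E')"

section \<open>Extending a path through one node of the decomposition\<close>

lemma root_of_subset:
  "root_of E D A E' r \<Longrightarrow> S \<subseteq> D \<Longrightarrow> B = A \<inter> S \<Longrightarrow> root_of E S B E' r"
  unfolding root_of_def by auto

lemma has_path_subset:
  assumes "has_path E S B s" "S \<subseteq> D" "B = A \<inter> S"
  shows "has_path E D A s"
  unfolding has_path_def
proof (intro allI impI)
  fix E' r assume "root_of E D A E' r"
  then have "path_minor (insert r S) r (s + 2) E'"
    using assms root_of_subset[OF _ assms(2,3)] unfolding has_path_def by blast
  then show "path_minor (insert r D) r (s + 2) E'"
    by (rule path_minor_mono) (use assms in auto)
qed

lemma has_path_imp_twin:
  assumes "has_path E D A s" shows "has_path_twin E D A s"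
  unfolding has_path_twin_def
proof (intro allI impI)
  fix E' r h assume "root_of E D A E' r \<and> root_of E D A E' h \<and> E' r h"
  then have "path_minor (insert r D) r (s + 2) E'" using assms unfolding has_path_def by blast
  then show "path_minor (insert h (insert r D)) r (s + 2) E'" by (rule path_minor_mono) auto
qed

lemma has_path_pendant:
  assumes path: "has_path E S A s" and E': "root_of E S A E' x"
    and r: "r \<notin> S" "r \<noteq> x" "E' r x" "\<And>y. y \<in> S \<Longrightarrow> \<not> E' r y"
  shows "path_minor (insert r (insert x S)) r (s + 3) E'"
proof -
  have "path_minor (insert x S) x (s + 2) E'" using path E' unfolding has_path_def by blast
  then have "path_minor (insert r (insert x S)) r (s + 2 + 1) E'"
    by (rule path_minor_pendant) (use r E' in \<open>auto simp: root_of_def\<close>)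
  then show ?thesis by (simp add: eval_nat_numeral)
qed

lemma has_path_leaf: "has_path E {x} {x} 0"
  unfolding has_path_def
proof (intro allI impI)
  fix E' r assume *: "root_of E {x} {x} E' r"
  then interpret simple_rel E' by (simp add: root_of_def)
  have "induced_path E' [x]" using irrefl by (simp add: induced_path_def)
  then have "induced_path E' (r # [x])"
    by (rule induced_path_Cons) (use * in \<open>auto simp: root_of_def\<close>)
  then show "path_minor {r, x} r (0 + 2) E'" by (intro path_minor.path[of E' r "[x]"]) auto
qed

text \<open>Pivoting \<open>x h\<close> hands the neighbourhood \<open>A\<close> of \<open>h\<close>
  to \<open>x\<close>. The vertex \<open>r\<close> is adjacent to both ends while \<open>A\<close>
  is adjacent to \<open>h\<close> only, so \<open>r\<close> loses \<open>A\<close> and becomes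
  pendant at \<open>x\<close>.\<close>

lemma path_minor_union:
  assumes path: "has_path E S A s" and r: "root_of E S A E' r" and h: "root_of E S A E' h" "E' r h"
    and x: "x \<notin> S" "E' r x" "E' h x" "\<And>y. y \<in> S \<Longrightarrow> \<not> E' x y"
  shows "path_minor (insert r (insert h (insert x S))) r (s + 3) E'"
proof -
  interpret simple_rel E' using r by (simp add: root_of_def)
  have xh: "E' x h" "E' x r" "E' h r" using x h sym by auto
  have ne: "x \<noteq> h" "x \<noteq> r" "r \<noteq> h" using xh irrefl by metis+
  note pv = piv_first[OF xh(1)] piv_second[OF xh(1)] piv_other[OF xh(1)]
  have "path_minor (insert r (insert x S)) r (s + 3) (piv E' x h)"
  proof (rule has_path_pendant[OF path])
    have "piv E' x h a b = E a b" if "a \<in> S" "b \<in> S" for a b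
      using pv(5)[of a b] that x h r by (auto simp: root_of_def)
    moreover have "piv E' x h x y \<longleftrightarrow> y \<in> A" if "y \<in> S" for y
      using pv(1)[of y] that x h r by (auto simp: root_of_def)
    ultimately show "root_of E S A (piv E' x h) x"
      using simple_rel_piv x by (simp add: root_of_def)
    show "piv E' x h r x" using pv(2)[of r] xh ne by auto
    show "\<not> piv E' x h r y" if "y \<in> S" for y
      using pv(5)[of r y] that x h r xh ne by (auto simp: root_of_def)
  qed (use r ne in \<open>auto simp: root_of_def\<close>)
  then have "path_minor (insert r (insert h (insert x S))) r (s + 3) (piv E' x h)"
    by (rule path_minor_mono) auto
  then show ?thesis by (intro path_minor.pivot[of E' x h]) (use xh ne in auto)
qed

text \<open>Pivoting \<open>r x\<close> moves \<open>A\<close> from \<open>r\<close> to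
  \<open>x\<close>, so that \<open>r\<close> is pendant at \<open>x\<close>.\<close>

lemma path_minor_pivot_root:
  assumes path: "has_path E S A s" and r: "root_of E S A E' r"
    and x: "x \<notin> S" "E' r x" "\<And>y. y \<in> S \<Longrightarrow> \<not> E' x y"
  shows "path_minor (insert r (insert x S)) r (s + 3) (piv E' r x)"
proof -
  interpret simple_rel E' using r by (simp add: root_of_def)
  have ne: "x \<noteq> r" using x irrefl by metis
  note pv = piv_first[OF x(2)] piv_second[OF x(2)] piv_other[OF x(2)]
  show ?thesis
  proof (rule has_path_pendant[OF path])
    have "piv E' r x a b = E a b" if "a \<in> S" "b \<in> S" for a b
      using pv(5)[of a b] that x r by (auto simp: root_of_def)
    moreover have "piv E' r x x y \<longleftrightarrow> y \<in> A" if "y \<in> S" for y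
      using pv(3)[of y] that x r by (auto simp: root_of_def)
    ultimately show "root_of E S A (piv E' r x) x"
      using simple_rel_piv x by (simp add: root_of_def)
    show "piv E' r x r x" using piv_edge x by blast
    show "\<not> piv E' r x r y" if "y \<in> S" for y
      using pv(1)[of y] that x r ne by (auto simp: root_of_def)
  qed (use r ne in \<open>auto simp: root_of_def\<close>)
qed

text \<open>Pivoting \<open>x c\<close> moves \<open>A\<close> from \<open>c\<close> to
  \<open>x\<close> and separates \<open>r\<close> from both \<open>x\<close> and \<open>A\<close>.
  The path now starts with r, c, x: two new vertices from one pivot.\<close>

lemma path_minor_attach_union:
  assumes path: "has_path E S A s" and r: "root_of E S A E' r" and c: "root_of E S A E' c" "\<not> E' r c" "r \<noteq> c"
    and x: "x \<notin> S" "E' r x" "E' c x" "\<And>y. y \<in> S \<Longrightarrow> \<not> E' x y"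
  shows "path_minor (insert r (insert c (insert x S))) r (s + 4) E'"
proof -
  interpret simple_rel E' using r by (simp add: root_of_def)
  have xc: "E' x c" "E' x r" using x sym by auto
  have ne: "x \<noteq> c" "x \<noteq> r" using xc irrefl by metis+
  note pv = piv_first[OF xc(1)] piv_second[OF xc(1)] piv_other[OF xc(1)]
  have "path_minor (insert c (insert x S)) c (s + 3) (piv E' x c)"
  proof (rule has_path_pendant[OF path])
    have "piv E' x c a b = E a b" if "a \<in> S" "b \<in> S" for a b
      using pv(5)[of a b] that x c r by (auto simp: root_of_def)
    moreover have "piv E' x c x y \<longleftrightarrow> y \<in> A" if "y \<in> S" for y
      using pv(1)[of y] that x c r by (auto simp: root_of_def)
    ultimately show "root_of E S A (piv E' x c) x"
      using simple_rel_piv x by (simp add: root_of_def)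
    show "piv E' x c c x" using piv_edge xc by blast
    show "\<not> piv E' x c c y" if "y \<in> S" for y
      using pv(3)[of y] that x c by (auto simp: root_of_def)
  qed (use c ne in \<open>auto simp: root_of_def\<close>)
  then have "path_minor (insert r (insert c (insert x S))) r (s + 3 + 1) (piv E' x c)"
  proof (rule path_minor_pendant)
    show "piv E' x c r c" using pv(4)[of r] xc ne c by auto
    show "\<not> piv E' x c r y" if "y \<in> insert c (insert x S)" "y \<noteq> c" for y
      using pv(2)[of r] pv(5)[of r y] that xc ne c r x sym_iff[of c r]
      by (cases "y = x") (auto simp: root_of_def)
  qed (use simple_rel_piv r ne c in \<open>auto simp: root_of_def\<close>)
  then have "path_minor (insert r (insert c (insert x S))) r (s + 4) (piv E' x c)"
    by (simp add: eval_nat_numeral)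
  then show ?thesis by (intro path_minor.pivot[of E' x c]) (use xc ne c in auto)
qed

text \<open>After pivoting \<open>x c\<close>, the vertices \<open>x\<close> and \<open>c\<close>
  are adjacent twins over \<open>S\<close>, while \<open>r\<close> loses \<open>A\<close> and
  \<open>x\<close> and is pendant at \<open>c\<close>. So \<open>c\<close> is the new root, and
  \<open>x\<close> its twin for \<open>has_path_twin\<close>.\<close>

lemma path_minor_attach_join:
  assumes path: "has_path_twin E S A s"
    and r: "root_of E S A E' r" and c: "root_of E S A E' c" "\<not> E' r c" "r \<noteq> c"
    and x: "root_of E S A E' x" "E' r x" "E' c x"
  shows "path_minor (insert r (insert c (insert x S))) r (s + 3) E'"
proof -
  interpret simple_rel E' using r by (simp add: root_of_def)
  have xc: "E' x c" "E' x r" using x sym by auto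
  have ne: "x \<noteq> c" "x \<noteq> r" using xc irrefl by metis+
  note pv = piv_first[OF xc(1)] piv_second[OF xc(1)] piv_other[OF xc(1)]
  have same: "piv E' x c a b = E a b" if "a \<in> S" "b \<in> S" for a b
    using pv(5)[of a b] that x c r by (auto simp: root_of_def)
  have "piv E' x c x y \<longleftrightarrow> y \<in> A" "piv E' x c c y \<longleftrightarrow> y \<in> A" if "y \<in> S" for y
    using pv(1,3)[of y] that x c by (auto simp: root_of_def)
  then have "root_of E S A (piv E' x c) x" "root_of E S A (piv E' x c) c"
    using same simple_rel_piv x c by (simp_all add: root_of_def)
  moreover have "piv E' x c c x" using piv_edge xc by blast
  ultimately have "path_minor (insert x (insert c S)) c (s + 2) (piv E' x c)"
    using path unfolding has_path_twin_def by blast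
  then have "path_minor (insert r (insert x (insert c S))) r (s + 2 + 1) (piv E' x c)"
  proof (rule path_minor_pendant)
    show "piv E' x c r c" using pv(4)[of r] xc ne c by auto
    show "\<not> piv E' x c r y" if "y \<in> insert x (insert c S)" "y \<noteq> c" for y
      using pv(2)[of r] pv(5)[of r y] that xc ne c r x sym_iff[of c r]
      by (cases "y = x") (auto simp: root_of_def)
  qed (use simple_rel_piv r ne c in \<open>auto simp: root_of_def\<close>)
  then have "path_minor (insert r (insert c (insert x S))) r (s + 3) (piv E' x c)"
    by (simp add: eval_nat_numeral insert_commute)
  then show ?thesis by (intro path_minor.pivot[of E' x c]) (use xc ne c in auto)
qed


lemma root_of_member:
  assumes "root_of E D A E' r" "S \<subseteq> D" "v \<in> D" "v \<notin> S" "\<And>y. y \<in> S \<Longrightarrow> E v y \<longleftrightarrow> y \<in> B"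
  shows "root_of E S B E' v"
  using assms unfolding root_of_def by (metis subsetD)

lemma has_path_union_twin:
  assumes path: "has_path E S B s" and S: "S \<subseteq> D" "B = A \<inter> S"
    and x: "x \<in> A" "x \<in> D" "x \<notin> S" "\<And>y. y \<in> S \<Longrightarrow> \<not> E x y"
  shows "has_path_twin E D A (s + 1)"
  unfolding has_path_twin_def
proof (intro allI impI)
  fix E' r h assume *: "root_of E D A E' r \<and> root_of E D A E' h \<and> E' r h"
  then have r: "root_of E D A E' r" "root_of E D A E' h" "E' r h" by blast+
  have "path_minor (insert r (insert h (insert x S))) r (s + 3) E'"
  proof (rule path_minor_union[OF path root_of_subset[OF r(1) S] root_of_subset[OF r(2) S] r(3) x(3)])
    show "\<not> E' x y" if "y \<in> S" for y using that r(1) S x by (auto simp: root_of_def)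
  qed (use r(1,2) x in \<open>auto simp: root_of_def\<close>)
  then show "path_minor (insert h (insert r D)) r (s + 1 + 2) E'"
    by (rule path_minor_mono) (use S x in auto)
qed

text \<open>A vertex \<open>h\<close> of the sibling part supplies the adjacent twin of the root
  that \<open>has_path_twin\<close> demands.\<close>

lemma has_path_join:
  assumes path: "has_path_twin E S B s" and S: "S \<subseteq> D" "B = A \<inter> S"
    and h: "h \<in> A" "h \<in> D" "h \<notin> S" "\<And>y. y \<in> S \<Longrightarrow> E h y \<longleftrightarrow> y \<in> B"
  shows "has_path E D A s"
  unfolding has_path_def
proof (intro allI impI)
  fix E' r assume r: "root_of E D A E' r"
  have "E' r h" using r h by (auto simp: root_of_def)
  then have "path_minor (insert h (insert r S)) r (s + 2) E'"
    using path root_of_subset[OF r S] root_of_member[OF r S(1) h(2,3,4)]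
    unfolding has_path_twin_def by blast
  then show "path_minor (insert r D) r (s + 2) E'"
    by (rule path_minor_mono) (use S h in auto)
qed

lemma has_path_attach:
  assumes path: "has_path E S B s" and S: "S \<subseteq> D" "S \<inter> A = {}"
    and x: "x \<in> A" "x \<in> D" "\<And>y. y \<in> S \<Longrightarrow> E x y \<longleftrightarrow> y \<in> B"
  shows "has_path E D A (s + 1)"
  unfolding has_path_def
proof (intro allI impI)
  fix E' r assume r: "root_of E D A E' r"
  have "x \<notin> S" using x S by auto
  have "path_minor (insert r (insert x S)) r (s + 3) E'"
    by (rule has_path_pendant[OF path root_of_member[OF r S(1) x(2) \<open>x \<notin> S\<close> x(3)]])
      (use r S x in \<open>auto simp: root_of_def\<close>)
  then show "path_minor (insert r D) r (s + 1 + 2) E'"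
    by (rule path_minor_mono) (use S x in auto)
qed

text \<open>Two stars are passed and the path gains two vertices. Only one is claimed, since the
  ordering is charged for only one star.\<close>

lemma has_path_attach_union:
  assumes path: "has_path E S B s" and S: "S \<subseteq> D" "B = A \<inter> S"
    and x: "x \<in> A" "x \<in> D" "x \<notin> S" "\<And>y. y \<in> S \<Longrightarrow> \<not> E x y"
    and c: "c \<notin> A" "c \<in> D" "c \<notin> S" "\<And>y. y \<in> S \<Longrightarrow> E c y \<longleftrightarrow> y \<in> B" "E c x"
  shows "has_path E D A (s + 1)"
  unfolding has_path_def
proof (intro allI impI)
  fix E' r assume r: "root_of E D A E' r"
  have "path_minor (insert r (insert c (insert x S))) r (s + 4) E'"
  proof (rule path_minor_attach_union[OF path root_of_subset[OF r S] root_of_member[OF r S(1) c(2,3,4)]])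
    show "\<not> E' x y" if "y \<in> S" for y using that r S x by (auto simp: root_of_def)
  qed (use r S x c in \<open>auto simp: root_of_def\<close>)
  then show "path_minor (insert r D) r (s + 1 + 2) E'"
    by (rule path_minor_mono) (use S x c in auto)
qed

lemma has_path_attach_join:
  assumes path: "has_path_twin E S B s" and S: "S \<subseteq> D" "B = A \<inter> S"
    and x: "x \<in> A" "x \<in> D" "x \<notin> S" "\<And>y. y \<in> S \<Longrightarrow> E x y \<longleftrightarrow> y \<in> B"
    and c: "c \<notin> A" "c \<in> D" "c \<notin> S" "\<And>y. y \<in> S \<Longrightarrow> E c y \<longleftrightarrow> y \<in> B" "E c x"
  shows "has_path E D A (s + 1)"
  unfolding has_path_def
proof (intro allI impI)
  fix E' r assume r: "root_of E D A E' r"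
  have "path_minor (insert r (insert c (insert x S))) r (s + 3) E'"
    by (rule path_minor_attach_join[OF path root_of_subset[OF r S] root_of_member[OF r S(1) c(2,3,4)]
          _ _ root_of_member[OF r S(1) x(2,3,4)]])
      (use r S x c in \<open>auto simp: root_of_def\<close>)
  then show "path_minor (insert r D) r (s + 1 + 2) E'"
    by (rule path_minor_mono) (use S x c in auto)
qed

text \<open>The invariant for parts below a star: the width is unbordered, because the star node
  itself pays for the root.\<close>

definition weak_layout :: "('a \<Rightarrow> 'a \<Rightarrow> bool) \<Rightarrow> 'a set \<Rightarrow> 'a set \<Rightarrow> bool" where
  "weak_layout E D A \<longleftrightarrow> (\<exists>s xs. distinct xs \<and> set xs = D \<and> cut_width_le E xs (2 * s + 1) \<and> has_path E D A s)"

text \<open>The invariant for parts below a clique node: such a node adds nothing to the bordered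
  width and provides the twin.\<close>

definition twin_layout :: "('a \<Rightarrow> 'a \<Rightarrow> bool) \<Rightarrow> 'a set \<Rightarrow> 'a set \<Rightarrow> bool" where
  "twin_layout E D A \<longleftrightarrow>
     (\<exists>s xs. distinct xs \<and> set xs = D \<and> bordered_width_le E A xs (2 * s + 1) \<and> has_path_twin E D A s)"

definition strong_layout :: "('a \<Rightarrow> 'a \<Rightarrow> bool) \<Rightarrow> 'a set \<Rightarrow> 'a set \<Rightarrow> bool" where
  "strong_layout E D A \<longleftrightarrow>
     (\<exists>s xs. distinct xs \<and> set xs = D \<and> bordered_width_le E A xs (2 * s + 1) \<and> has_path E D A s)"

lemma strong_imp_weak: "strong_layout E D A \<Longrightarrow> weak_layout E D A"
  unfolding strong_layout_def weak_layout_def using cut_width_le_if_bordered by metis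

lemma strong_imp_twin: "strong_layout E D A \<Longrightarrow> twin_layout E D A"
  unfolding strong_layout_def twin_layout_def using has_path_imp_twin by metis

lemma strong_layout_leaf: "strong_layout E {x} {x}"
proof -
  have "bordered_width_le E {x} [x] (2 * 0 + 1)" using bordered_width_le_leaf[of E x] by simp
  then show ?thesis unfolding strong_layout_def using has_path_leaf[of E x]
    by (intro exI[of _ 0] exI[of _ "[x]"]) simp
qed

subsection \<open>Orderings and paths of a rooted split decomposition\<close>

text \<open>In contrast to \<open>strong_layout\<close>, one initial pivot may use the root.\<close>

definition rooted_layout :: "('a \<Rightarrow> 'a \<Rightarrow> bool) \<Rightarrow> 'a set \<Rightarrow> 'a set \<Rightarrow> bool" where
  "rooted_layout E D A \<longleftrightarrow>
     (\<exists>s xs. distinct xs \<and> set xs = D \<and> bordered_width_le E A xs (2 * s + 1) \<and>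
       (\<forall>E' r. root_of E D A E' r \<longrightarrow> path_minor (insert r D) r (s + 2) E' \<or>
         (\<exists>x \<in> D. E' r x \<and> path_minor (insert r D) r (s + 2) (piv E' r x))))"

lemma strong_imp_rooted: "strong_layout E D A \<Longrightarrow> rooted_layout E D A"
  unfolding strong_layout_def rooted_layout_def has_path_def by metis

context simple_rel
begin

context
  fixes D1 A1 D2 A2 :: "'a set"
  assumes dec: "A1 \<subseteq> D1" "A1 \<noteq> {}" "A2 \<subseteq> D2" "A2 \<noteq> {}" and disj: "D1 \<inter> D2 = {}"
begin

lemma union_orderings:
  assumes no: "\<And>x y. x \<in> D1 \<Longrightarrow> y \<in> D2 \<Longrightarrow> \<not> E x y"
    and "weak_layout E D1 A1" "weak_layout E D2 A2"
  obtains s1 s2 xs ys where "distinct (xs @ ys)" "set xs = D1" "set ys = D2"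
    "cut_width_le E xs (2 * max s1 s2 + 1)" "cut_width_le E ys (2 * max s1 s2 + 1)"
    "cut_width_le E (xs @ ys) (2 * max s1 s2 + 1)" "has_path E D1 A1 s1" "has_path E D2 A2 s2"
proof -
  obtain s1 xs s2 ys where *: "distinct xs" "set xs = D1" "cut_width_le E xs (2 * s1 + 1)" "has_path E D1 A1 s1"
    "distinct ys" "set ys = D2" "cut_width_le E ys (2 * s2 + 1)" "has_path E D2 A2 s2"
    using assms(2,3) unfolding weak_layout_def by blast
  have c: "cut_width_le E xs (2 * max s1 s2 + 1)" "cut_width_le E ys (2 * max s1 s2 + 1)"
    by (rule cut_width_le_mono[OF *(3)] cut_width_le_mono[OF *(7)], simp)+
  moreover have "cut_width_le E (xs @ ys) (2 * max s1 s2 + 1)"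
    using cut_width_le_append[OF c] no * by blast
  moreover have "distinct (xs @ ys)" using * disj by simp
  ultimately show thesis using that * by blast
qed

text \<open>No star is counted here: the root's row and column are absent from the width, and the
  path of the better part is reused as it is.\<close>

lemma weak_layout_union:
  assumes no: "\<And>x y. x \<in> D1 \<Longrightarrow> y \<in> D2 \<Longrightarrow> \<not> E x y"
    and lay: "weak_layout E D1 A1" "weak_layout E D2 A2"
  shows "weak_layout E (D1 \<union> D2) (A1 \<union> A2)"
proof -
  obtain s1 s2 xs ys where *: "distinct (xs @ ys)" "set xs = D1" "set ys = D2"
    "cut_width_le E (xs @ ys) (2 * max s1 s2 + 1)" "has_path E D1 A1 s1" "has_path E D2 A2 s2"
    using union_orderings[OF no lay] by metis
  have "has_path E (D1 \<union> D2) (A1 \<union> A2) (max s1 s2)"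
  proof (cases "s1 \<le> s2")
    case True
    then show ?thesis using has_path_subset[OF *(6), of "D1 \<union> D2" "A1 \<union> A2"] dec disj by (auto simp: max_def)
  next
    case False
    then show ?thesis using has_path_subset[OF *(5), of "D1 \<union> D2" "A1 \<union> A2"] dec disj by (auto simp: max_def)
  qed
  then show ?thesis unfolding weak_layout_def using *
    by (intro exI[of _ "max s1 s2"] exI[of _ "xs @ ys"]) auto
qed

text \<open>Now the star is counted: the border costs 2, and a root neighbour in the other part
  lengthens the path of the better part by one vertex.\<close>

lemma twin_layout_union:
  assumes no: "\<And>x y. x \<in> D1 \<Longrightarrow> y \<in> D2 \<Longrightarrow> \<not> E x y"
    and lay: "weak_layout E D1 A1" "weak_layout E D2 A2"
  shows "twin_layout E (D1 \<union> D2) (A1 \<union> A2)"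
proof -
  obtain s1 s2 xs ys where *: "distinct (xs @ ys)" "set xs = D1" "set ys = D2"
    "cut_width_le E xs (2 * max s1 s2 + 1)" "cut_width_le E ys (2 * max s1 s2 + 1)"
    "has_path E D1 A1 s1" "has_path E D2 A2 s2"
    using union_orderings[OF no lay] by metis
  obtain a1 a2 where a: "a1 \<in> A1" "a2 \<in> A2" using dec by blast
  have "has_path_twin E (D1 \<union> D2) (A1 \<union> A2) (max s1 s2 + 1)"
  proof (cases "s1 \<le> s2")
    case True
    have "has_path_twin E (D1 \<union> D2) (A1 \<union> A2) (s2 + 1)"
      by (rule has_path_union_twin[OF *(7), of _ _ a1]) (use dec disj a no in auto)
    then show ?thesis using True by (simp add: max_def)
  next
    case False
    have "has_path_twin E (D1 \<union> D2) (A1 \<union> A2) (s1 + 1)"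
      by (rule has_path_union_twin[OF *(6), of _ _ a2]) (use dec disj a no sym in blast)+
    then show ?thesis using False by (simp add: max_def)
  qed
  moreover have "bordered_width_le E (A1 \<union> A2) (xs @ ys) (2 * (max s1 s2 + 1) + 1)"
    using bordered_width_le_union[OF *(4,5), of "A1 \<union> A2"] no * by (simp add: eval_nat_numeral)
  ultimately show ?thesis unfolding twin_layout_def using *
    by (intro exI[of _ "max s1 s2 + 1"] exI[of _ "xs @ ys"]) auto
qed

lemma rooted_layout_union:
  assumes no: "\<And>x y. x \<in> D1 \<Longrightarrow> y \<in> D2 \<Longrightarrow> \<not> E x y"
    and lay: "weak_layout E D1 A1" "weak_layout E D2 A2"
  shows "rooted_layout E (D1 \<union> D2) (A1 \<union> A2)"
proof -
  let ?D = "D1 \<union> D2" and ?A = "A1 \<union> A2"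
  obtain s1 s2 xs ys where *: "distinct (xs @ ys)" "set xs = D1" "set ys = D2"
    "cut_width_le E xs (2 * max s1 s2 + 1)" "cut_width_le E ys (2 * max s1 s2 + 1)"
    "has_path E D1 A1 s1" "has_path E D2 A2 s2"
    using union_orderings[OF no lay] by metis
  obtain a1 a2 where a: "a1 \<in> A1" "a2 \<in> A2" using dec by blast
  have step: "\<exists>x \<in> ?D. E' r x \<and> path_minor (insert r ?D) r (s + 3) (piv E' r x)"
    if r: "root_of E ?D ?A E' r" and path: "has_path E S B s" and S: "S \<subseteq> ?D" "B = ?A \<inter> S"
      and x: "x \<in> ?A" "x \<in> ?D" "x \<notin> S" "\<And>y. y \<in> S \<Longrightarrow> \<not> E x y" for E' r S B s x
  proof -
    have rx: "E' r x" using r x by (auto simp: root_of_def)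
    have "\<not> E' x y" if "y \<in> S" for y using that r S x by (auto simp: root_of_def)
    then have "path_minor (insert r (insert x S)) r (s + 3) (piv E' r x)"
      using path_minor_pivot_root[OF path root_of_subset[OF r S] x(3) rx] by blast
    then have "path_minor (insert r ?D) r (s + 3) (piv E' r x)"
      by (rule path_minor_mono) (use S x in auto)
    then show ?thesis using x rx by blast
  qed
  have "\<exists>x \<in> ?D. E' r x \<and> path_minor (insert r ?D) r (max s1 s2 + 3) (piv E' r x)"
    if r: "root_of E ?D ?A E' r" for E' r
  proof (cases "s1 \<le> s2")
    case True
    have "\<exists>x \<in> ?D. E' r x \<and> path_minor (insert r ?D) r (s2 + 3) (piv E' r x)"
      by (rule step[OF r *(7), of a1]) (use dec disj a no in auto)
    then show ?thesis using True by (simp add: max_def)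
  next
    case False
    have no': "\<not> E a2 y" if "y \<in> D1" for y using no[of y a2] that a dec sym by blast
    have "\<exists>x \<in> ?D. E' r x \<and> path_minor (insert r ?D) r (s1 + 3) (piv E' r x)"
      by (rule step[OF r *(6), of a2]) (use dec disj a no' in auto)
    then show ?thesis using False by (simp add: max_def)
  qed
  then have "\<exists>x \<in> ?D. E' r x \<and> path_minor (insert r ?D) r (max s1 s2 + 1 + 2) (piv E' r x)"
    if "root_of E ?D ?A E' r" for E' r using that by (simp add: eval_nat_numeral)
  moreover have "bordered_width_le E ?A (xs @ ys) (2 * (max s1 s2 + 1) + 1)"
    using bordered_width_le_union[OF *(4,5), of ?A] no * by (simp add: eval_nat_numeral)
  moreover have "set (xs @ ys) = ?D" using * by simp
  ultimately show ?thesis unfolding rooted_layout_def using *(1) by metis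
qed

lemma join_orderings:
  assumes e: "\<And>x y. x \<in> D1 \<Longrightarrow> y \<in> D2 \<Longrightarrow> E x y \<longleftrightarrow> x \<in> A1 \<and> y \<in> A2"
    and "twin_layout E D1 A1" "twin_layout E D2 A2"
  obtains s1 s2 xs where "distinct xs" "set xs = D1 \<union> D2"
    "bordered_width_le E (A1 \<union> A2) xs (2 * max s1 s2 + 1)" "has_path_twin E D1 A1 s1" "has_path_twin E D2 A2 s2"
proof -
  obtain s1 xs where xs: "distinct xs" "set xs = D1" "bordered_width_le E A1 xs (2 * s1 + 1)" "has_path_twin E D1 A1 s1"
    using assms(2) unfolding twin_layout_def by metis
  obtain s2 ys where ys: "distinct ys" "set ys = D2" "bordered_width_le E A2 ys (2 * s2 + 1)" "has_path_twin E D2 A2 s2"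
    using assms(3) unfolding twin_layout_def by metis
  have c: "bordered_width_le E A1 xs (2 * max s1 s2 + 1)" "bordered_width_le E A2 ys (2 * max s1 s2 + 1)"
    using bordered_width_le_mono[OF xs(3)] bordered_width_le_mono[OF ys(3)] by simp_all
  have "bordered_width_le E (A1 \<union> A2) (xs @ ys) (2 * max s1 s2 + 1)"
    by (rule bordered_width_le_join[OF c], unfold xs(2) ys(2)) (fact disj dec e)+
  moreover have "distinct (xs @ ys)" "set (xs @ ys) = D1 \<union> D2"
    using xs(1,2) ys(1,2) disj by simp_all
  ultimately show thesis using that xs(4) ys(4) by blast
qed

lemma strong_layout_join:
  assumes e: "\<And>x y. x \<in> D1 \<Longrightarrow> y \<in> D2 \<Longrightarrow> E x y \<longleftrightarrow> x \<in> A1 \<and> y \<in> A2"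
    and lay: "twin_layout E D1 A1" "twin_layout E D2 A2"
  shows "strong_layout E (D1 \<union> D2) (A1 \<union> A2)"
proof -
  obtain s1 s2 xs where *: "distinct xs" "set xs = D1 \<union> D2"
    "bordered_width_le E (A1 \<union> A2) xs (2 * max s1 s2 + 1)" "has_path_twin E D1 A1 s1" "has_path_twin E D2 A2 s2"
    using join_orderings[OF e lay] by metis
  obtain a1 a2 where a: "a1 \<in> A1" "a2 \<in> A2" using dec by blast
  have "has_path E (D1 \<union> D2) (A1 \<union> A2) (max s1 s2)"
  proof (cases "s1 \<le> s2")
    case True
    have "E a1 y \<longleftrightarrow> y \<in> A2" if "y \<in> D2" for y using e[of a1 y] that a dec by auto
    then have "has_path E (D1 \<union> D2) (A1 \<union> A2) s2"
      by (intro has_path_join[OF *(5), of _ _ a1]) (use dec disj a in auto)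
    then show ?thesis using True by (simp add: max_def)
  next
    case False
    have "E a2 y \<longleftrightarrow> y \<in> A1" if "y \<in> D1" for y using e[of y a2] that a dec sym_iff[of y a2] by auto
    then have "has_path E (D1 \<union> D2) (A1 \<union> A2) s1"
      by (intro has_path_join[OF *(4), of _ _ a2]) (use dec disj a in auto)
    then show ?thesis using False by (simp add: max_def)
  qed
  then show ?thesis unfolding strong_layout_def using *
    by (intro exI[of _ "max s1 s2"] exI[of _ xs]) auto
qed

text \<open>The path may run into the attached part \<open>D2\<close> or into the centre
  \<open>D1\<close>, whichever has the larger number. The alternative \<open>s1 = 0\<close> covers a
  centre that is a single leaf, where the path into \<open>D2\<close> always suffices.\<close>

lemma strong_layout_attach:
  assumes e: "\<And>x y. x \<in> D1 \<Longrightarrow> y \<in> D2 \<Longrightarrow> E x y \<longleftrightarrow> x \<in> A1 \<and> y \<in> A2"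
    and xs: "distinct xs" "set xs = D1" "cut_width_le E xs (2 * s1 + 1)"
    and path: "s1 = 0 \<or> has_path E (D1 \<union> D2) A1 (s1 + 1)"
    and lay: "weak_layout E D2 A2"
  shows "strong_layout E (D1 \<union> D2) A1"
proof -
  obtain s2 ys where ys: "distinct ys" "set ys = D2" "cut_width_le E ys (2 * s2 + 1)" "has_path E D2 A2 s2"
    using lay unfolding weak_layout_def by metis
  define s where "s = max s1 s2"
  obtain a1 where a1: "a1 \<in> A1" using dec by blast
  have "E a1 y \<longleftrightarrow> y \<in> A2" if "y \<in> D2" for y using e[of a1 y] that a1 dec by auto
  then have p2: "has_path E (D1 \<union> D2) A1 (s2 + 1)"
    by (intro has_path_attach[OF ys(4), of _ _ a1]) (use dec disj a1 in auto)
  have "has_path E (D1 \<union> D2) A1 (s + 1)"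
  proof (cases "s1 \<le> s2")
    case True
    then show ?thesis using p2 by (simp add: s_def max_def)
  next
    case False
    then show ?thesis using path by (simp add: s_def max_def)
  qed
  moreover have "bordered_width_le E A1 (ys @ xs) (2 * (s + 1) + 1)"
  proof -
    have c: "cut_width_le E xs (2 * s + 1)" "cut_width_le E ys (2 * s + 1)"
      using cut_width_le_mono[OF xs(3)] cut_width_le_mono[OF ys(3)] by (simp_all add: s_def)
    have "bordered_width_le E A1 (ys @ xs) (2 * s + 1 + 2)"
      by (rule bordered_width_le_attach[OF c sym], assumption, unfold xs(2) ys(2)) (fact disj dec e)+
    then show ?thesis by (simp add: eval_nat_numeral)
  qed
  moreover have "distinct (ys @ xs)" "set (ys @ xs) = D1 \<union> D2"
    using xs(1,2) ys(1,2) disj by auto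
  ultimately show ?thesis unfolding strong_layout_def by metis
qed

end

text \<open>If the centre of the star of an \<open>attach\<close> node is again an \<open>attach\<close> node, then the two stars merge.\<close>

definition no_attach :: "'a set \<Rightarrow> 'a set \<Rightarrow> bool" where
  "no_attach D A \<longleftrightarrow> (\<exists>x. D = {x}) \<or> (\<exists>S T B C. D = S \<union> T \<and> A = B \<union> C \<and> S \<inter> T = {} \<and>
     rooted_decomp E S B \<and> rooted_decomp E T C \<and>
     ((\<forall>x \<in> S. \<forall>y \<in> T. \<not> E x y) \<or> (\<forall>x \<in> S. \<forall>y \<in> T. E x y \<longleftrightarrow> x \<in> B \<and> y \<in> C)))"

lemma attach_normal_form:
  assumes "rooted_decomp E D1 A1" "rooted_decomp E D2 A2" "D1 \<inter> D2 = {}"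
    and "\<And>x y. x \<in> D1 \<Longrightarrow> y \<in> D2 \<Longrightarrow> E x y \<longleftrightarrow> x \<in> A1 \<and> y \<in> A2"
  obtains D1' D2' A2' where "D1 \<union> D2 = D1' \<union> D2'" "D1' \<inter> D2' = {}" "rooted_decomp E D1' A1" "rooted_decomp E D2' A2'"
    "\<And>x y. x \<in> D1' \<Longrightarrow> y \<in> D2' \<Longrightarrow> E x y \<longleftrightarrow> x \<in> A1 \<and> y \<in> A2'" "no_attach D1' A1"
  using assms
proof (induction arbitrary: D2 A2 thesis rule: rooted_decomp.induct)
  case (leaf x)
  show ?case
    by (rule leaf(1)[OF refl leaf(3) rooted_decomp.leaf leaf(2,4)]) (auto simp: no_attach_def)
next
  case (union S B T C)
  have "no_attach (S \<union> T) (B \<union> C)" unfolding no_attach_def using union.hyps by metis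
  then show ?case
    by (intro union.prems(1)[OF refl union.prems(3) rooted_decomp.union[OF union.hyps] union.prems(2,4)])
next
  case (join S B T C)
  have "no_attach (S \<union> T) (B \<union> C)" unfolding no_attach_def using join.hyps by metis
  then show ?case
    by (intro join.prems(1)[OF refl join.prems(3) rooted_decomp.join[OF join.hyps] join.prems(2,4)])
next
  case (attach S B T C)
  have sub: "B \<subseteq> S" "C \<subseteq> T" using attach.hyps rooted_decomp_props by blast+
  have TD: "T \<inter> D2 = {}" "S \<inter> (T \<union> D2) = {}" using attach.prems(3) attach.hyps(3) by auto
  \<comment> \<open>\<open>D2\<close> sees only \<open>B\<close>, which lies in \<open>S\<close>, so
    there are no edges between \<open>T\<close> and \<open>D2\<close>. Attaching \<open>T\<close>
    and then \<open>D2\<close> to \<open>S\<close> thus amounts to attaching their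
    \<open>union\<close>, a node that \<open>weak_layout\<close> does not count.\<close>
  have dec: "rooted_decomp E (T \<union> D2) (C \<union> A2)"
    by (rule rooted_decomp.union[OF attach.hyps(2) attach.prems(2) TD(1)])
      (use attach.prems(4) attach.hyps(3) sub in blast)
  have e: "E x y \<longleftrightarrow> x \<in> B \<and> y \<in> C \<union> A2" if "x \<in> S" "y \<in> T \<union> D2" for x y
  proof (cases "y \<in> T")
    case True
    moreover have "y \<notin> A2" using True TD attach.prems(2) rooted_decomp_props by blast
    ultimately show ?thesis using attach.hyps(4)[of x y] that by simp
  next
    case False
    then show ?thesis using attach.prems(4)[of x y] that sub by auto
  qed
  show ?case
    by (rule attach.IH(1)[OF _ dec TD(2) e], simp_all only: Un_assoc[symmetric]) (rule attach.prems(1))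
qed

text \<open>The induction is on the size of \<open>D\<close>, not on the derivation, because
  \<open>attach_normal_form\<close> regroups the parts.\<close>

lemma rooted_decomp_layouts:
  "rooted_decomp E D A \<Longrightarrow> weak_layout E D A \<and> twin_layout E D A \<and> rooted_layout E D A"
proof (induction "card D" arbitrary: D A rule: less_induct)
  case less
  from less.prems show ?case
  proof (cases rule: rooted_decomp.cases)
    case (leaf x)
    then show ?thesis using strong_layout_leaf strong_imp_weak strong_imp_twin strong_imp_rooted by metis
  next
    case (union D1 A1 D2 A2)
    note c = card_rooted_decomp_Un[OF union(3-5)]
    have lay: "weak_layout E D1 A1" "weak_layout E D2 A2"
      using less.hyps union c by blast+
    have d: "A1 \<subseteq> D1" "A1 \<noteq> {}" "A2 \<subseteq> D2" "A2 \<noteq> {}"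
      using union(3,4) rooted_decomp_props by blast+
    show ?thesis
      unfolding union(1,2)
      using weak_layout_union[OF d union(5,6) lay] twin_layout_union[OF d union(5,6) lay]
        rooted_layout_union[OF d union(5,6) lay] by blast
  next
    case (join D1 A1 D2 A2)
    note c = card_rooted_decomp_Un[OF join(3-5)]
    have lay: "twin_layout E D1 A1" "twin_layout E D2 A2"
      using less.hyps join c by blast+
    have d: "A1 \<subseteq> D1" "A1 \<noteq> {}" "A2 \<subseteq> D2" "A2 \<noteq> {}"
      using join(3,4) rooted_decomp_props by blast+
    show ?thesis
      unfolding join(1,2)
      using strong_layout_join[OF d join(5,6) lay] strong_imp_weak strong_imp_twin strong_imp_rooted by blast
  next
    case (attach E1 E2 F2)
    obtain D1 D2 A2 where D: "D = D1 \<union> D2" and disj: "D1 \<inter> D2 = {}"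
      and dec: "rooted_decomp E D1 A" "rooted_decomp E D2 A2"
      and e: "\<And>x y. x \<in> D1 \<Longrightarrow> y \<in> D2 \<Longrightarrow> E x y \<longleftrightarrow> x \<in> A \<and> y \<in> A2"
      and form: "no_attach D1 A"
      using attach_normal_form[OF attach(2-5)] unfolding attach(1) by blast
    note c = card_rooted_decomp_Un[OF dec disj, folded D]
    have lay2: "weak_layout E D2 A2" using less.hyps dec c by blast
    have d: "A \<subseteq> D1" "A \<noteq> {}" "A2 \<subseteq> D2" "A2 \<noteq> {}"
      using dec rooted_decomp_props by blast+
    \<comment> \<open>In \<open>D1\<close> the vertex \<open>q\<close> has the same neighbours as
      the root, and it is not adjacent to the root: it is the \<open>c\<close> of the two attach
      lemmas.\<close>
    obtain q where q: "q \<in> A2" "q \<in> D2" "q \<notin> D1" "q \<notin> A" using d disj by blast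
    have eq: "E q y \<longleftrightarrow> y \<in> A" if "y \<in> D1" for y using e[of y q] that q sym_iff[of q y] by auto
    have "\<exists>s xs. distinct xs \<and> set xs = D1 \<and> cut_width_le E xs (2 * s + 1) \<and>
      (s = 0 \<or> has_path E (D1 \<union> D2) A (s + 1))"
      using form unfolding no_attach_def
    proof (elim disjE exE conjE)
      fix x assume x: "D1 = {x}"
      then have "cut_width_le E [x] (2 * 0 + 1)"
        using cut_width_le_if_bordered[OF bordered_width_le_leaf] by simp
      then show ?thesis using x by (intro exI[of _ 0] exI[of _ "[x]"]) simp
    next
      fix S T B C
      assume D1: "D1 = S \<union> T" and A: "A = B \<union> C" and ST: "S \<inter> T = {}"
        and ds: "rooted_decomp E S B" "rooted_decomp E T C" and no: "\<forall>x \<in> S. \<forall>y \<in> T. \<not> E x y"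
      have "card S < card D" "card T < card D"
        using card_rooted_decomp_Un[OF ds ST] c D1 by auto
      then have lay: "weak_layout E S B" "weak_layout E T C" using less.hyps ds by blast+
      have d': "B \<subseteq> S" "B \<noteq> {}" "C \<subseteq> T" "C \<noteq> {}" using ds rooted_decomp_props by blast+
      obtain s1 s2 xs ys where *: "distinct (xs @ ys)" "set xs = S" "set ys = T"
        "cut_width_le E (xs @ ys) (2 * max s1 s2 + 1)" "has_path E S B s1" "has_path E T C s2"
        using union_orderings[OF d' ST _ lay] no by metis
      obtain b c where bc: "b \<in> B" "c \<in> C" using d' by blast
      have "has_path E (D1 \<union> D2) A (max s1 s2 + 1)"
      proof (cases "s1 \<le> s2")
        case True
        have "has_path E (D1 \<union> D2) A (s2 + 1)"
          by (rule has_path_attach_union[OF *(6), of _ _ b q])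
            (use D1 A ST d' bc q no eq in auto)
        then show ?thesis using True by (simp add: max_def)
      next
        case False
        have "\<not> E c y" if "y \<in> S" for y using no that bc d' sym by blast
        then have "has_path E (D1 \<union> D2) A (s1 + 1)"
          by (intro has_path_attach_union[OF *(5), of _ _ c q])
            (use D1 A ST d' bc q eq in auto)
        then show ?thesis using False by (simp add: max_def)
      qed
      then show ?thesis
        using * D1 by (intro exI[of _ "max s1 s2"] exI[of _ "xs @ ys"]) auto
    next
      fix S T B C
      assume D1: "D1 = S \<union> T" and A: "A = B \<union> C" and ST: "S \<inter> T = {}"
        and ds: "rooted_decomp E S B" "rooted_decomp E T C"
        and all: "\<forall>x \<in> S. \<forall>y \<in> T. E x y \<longleftrightarrow> x \<in> B \<and> y \<in> C"
      have "card S < card D" "card T < card D"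
        using card_rooted_decomp_Un[OF ds ST] c D1 by auto
      then have lay: "twin_layout E S B" "twin_layout E T C" using less.hyps ds by blast+
      have d': "B \<subseteq> S" "B \<noteq> {}" "C \<subseteq> T" "C \<noteq> {}" using ds rooted_decomp_props by blast+
      obtain s1 s2 xs where *: "distinct xs" "set xs = S \<union> T"
        "bordered_width_le E (B \<union> C) xs (2 * max s1 s2 + 1)" "has_path_twin E S B s1" "has_path_twin E T C s2"
        using join_orderings[OF d' ST _ lay] all by metis
      obtain b c where bc: "b \<in> B" "c \<in> C" using d' by blast
      have "has_path E (D1 \<union> D2) A (max s1 s2 + 1)"
      proof (cases "s1 \<le> s2")
        case True
        have "E b y \<longleftrightarrow> y \<in> C" if "y \<in> T" for y using all that bc d' by blast
        then have "has_path E (D1 \<union> D2) A (s2 + 1)"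
          by (intro has_path_attach_join[OF *(5), of _ _ b q])
            (use D1 A ST d' bc q eq in auto)
        then show ?thesis using True by (simp add: max_def)
      next
        case False
        have "E c y \<longleftrightarrow> y \<in> B" if "y \<in> S" for y using all that bc d' sym by blast
        then have "has_path E (D1 \<union> D2) A (s1 + 1)"
          by (intro has_path_attach_join[OF *(4), of _ _ c q])
            (use D1 A ST d' bc q eq in auto)
        then show ?thesis using False by (simp add: max_def)
      qed
      then show ?thesis
        using * D1 cut_width_le_if_bordered by metis
    qed
    then have "strong_layout E (D1 \<union> D2) A"
      using strong_layout_attach[OF d disj e _ _ _ _ lay2] by blast
    then show ?thesis using D strong_imp_weak strong_imp_twin strong_imp_rooted by blast
  qed
qed

end

subsection \<open>Pivot-minors and linear rank-width\<close>

context simple_rel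
begin

text \<open>The components are ordered one after another, each with its own root. \<open>U\<close>
  stays fixed while \<open>V\<close> shrinks, so the excluded paths are those of the whole graph
  throughout.\<close>

lemma ordering_if_no_path:
  assumes n: "n \<ge> 3"
    and no_path: "\<And>r. \<not> path_minor U r n E" "\<And>r x. r \<in> U \<Longrightarrow> x \<in> U \<Longrightarrow> E r x \<Longrightarrow> \<not> path_minor U r n (piv E r x)"
  shows "finite V \<Longrightarrow> dist_hered E V \<Longrightarrow> V \<subseteq> U \<Longrightarrow>
    \<exists>xs. distinct xs \<and> set xs = V \<and> cut_width_le E xs (2 * n - 5)"
proof (induction "card V" arbitrary: V rule: less_induct)
  case less
  show ?case
  proof (cases "V = {}")
    case True
    then show ?thesis by (intro exI[of _ "[]"]) (simp add: cut_width_le_def rank_le_def)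
  next
    case False
    then obtain r where r: "r \<in> V" by blast
    let ?C = "component V r"
    have C: "?C \<subseteq> V" "r \<in> ?C" "connected_in E ?C"
      using component_subset[OF r] component_self connected_component[OF r] by auto
    have fin: "finite ?C" using C less.prems finite_subset by blast
    have "card (V - ?C) < card V" using C r less.prems by (intro psubset_card_mono) auto
    then obtain ys where ys: "distinct ys" "set ys = V - ?C" "cut_width_le E ys (2 * n - 5)"
      using less.hyps[of "V - ?C"] less.prems dist_hered_subset[of E V "V - ?C"] by blast
    obtain xs where xs: "distinct xs" "set xs = ?C" "cut_width_le E xs (2 * n - 5)"
    proof (cases "card ?C \<ge> 2")
      case False
      then have "card ?C = 1" using fin C by (cases "card ?C") auto
      then have "?C = {r}" using C by (auto simp: card_1_singleton_iff)
      moreover have "cut_width_le E [r] (2 * n - 5)"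
        by (rule cut_width_le_mono[OF cut_width_le_if_bordered[OF bordered_width_le_leaf]]) (use n in simp)
      ultimately show thesis using that[of "[r]"] by simp
    next
      case True
      let ?D = "?C - {r}" and ?A = "{y \<in> ?C. E r y}"
      have "rooted_decomp E ?D ?A"
        using dist_hered_rooted_decomp[OF fin True C(3) _ C(2)] dist_hered_subset[OF less.prems(2) C(1)] by blast
      then have "rooted_layout E ?D ?A" using rooted_decomp_layouts by blast
      moreover have root: "root_of E ?D ?A E r" using simple_rel_axioms irrefl by (auto simp: root_of_def)
      ultimately obtain s xs where s: "distinct xs" "set xs = ?D" "bordered_width_le E ?A xs (2 * s + 1)"
        "path_minor (insert r ?D) r (s + 2) E \<or>
         (\<exists>x \<in> ?D. E r x \<and> path_minor (insert r ?D) r (s + 2) (piv E r x))"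
        unfolding rooted_layout_def by blast
      have "s + 2 < n"
      proof (rule ccontr)
        assume "\<not> s + 2 < n"
        then have up: "path_minor U r n E'" if "path_minor (insert r ?D) r (s + 2) E'" for E'
          using path_minor_mono[OF that, of U n] C less.prems(3) by auto
        have "r \<in> U" "?D \<subseteq> U" using r C less.prems by auto
        then show False using s(4) up no_path by blast
      qed
      \<comment> \<open>From \<open>s + 2 < n\<close> follows \<open>s \<le> n - 3\<close>, hence
        \<open>2 * s + 1 \<le> 2 * n - 5\<close>.\<close>
      then have "cut_width_le E (r # xs) (2 * n - 5)"
        by (intro cut_width_le_mono[OF cut_width_le_Cons[OF s(3)]]) (use s(2) irrefl in auto)
      moreover have "distinct (r # xs)" "set (r # xs) = ?C" using s C by auto
      ultimately show thesis using that by blast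
    qed
    have "\<not> E x y" if "x \<in> ?C" "y \<in> V - ?C" for x y
      using component_closed[OF that(1) r] that by blast
    then have "cut_width_le E (xs @ ys) (2 * n - 5)"
      using cut_width_le_append[OF xs(3) ys(3)] xs ys by blast
    moreover have "distinct (xs @ ys)" "set (xs @ ys) = V" using xs ys C by auto
    ultimately show ?thesis by blast
  qed
qed

end

section \<open>From adjacency relations to graphs and their pivot-minors\<close>

definition adj :: "'a pair_pre_digraph \<Rightarrow> 'a \<Rightarrow> 'a \<Rightarrow> bool" where
  "adj G x y \<longleftrightarrow> (x, y) \<in> parcs G"

lemma adj_local_complement: "adj (local_complement G u) = loc_compl (adj G) u"
  by (auto simp: fun_eq_iff adj_def local_complement_def loc_compl_def Let_def)

lemma adj_pivot: "adj (pivot G u v) = piv (adj G) u v"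
  by (simp add: pivot_def piv_def adj_local_complement)

lemma pair_wf_local_complement: "pair_wf_digraph G \<Longrightarrow> pair_wf_digraph (local_complement G u)"
  unfolding pair_wf_digraph_def local_complement_def by (auto simp: Let_def)

lemma pverts_pivot: "pverts (pivot G u v) = pverts G"
  by (simp add: pivot_def local_complement_def Let_def)

lemma pair_wf_pivot: "pair_wf_digraph G \<Longrightarrow> pair_wf_digraph (pivot G u v)"
  by (simp add: pivot_def pair_wf_local_complement)

definition induced :: "'a pair_pre_digraph \<Rightarrow> 'a set \<Rightarrow> 'a pair_pre_digraph" where
  "induced G S = \<lparr> pverts = S, parcs = {(x, y) \<in> parcs G. x \<in> S \<and> y \<in> S} \<rparr>"

lemma pivot_minor_induced:
  assumes "pivot_minor H G" "pair_wf_digraph H" "finite T" "T \<subseteq> pverts H"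
  shows "pivot_minor (induced H (pverts H - T)) G"
  using assms(3,4)
proof (induction rule: finite_induct)
  case empty
  interpret pair_wf_digraph H by fact
  have "induced H (pverts H) = H"
    by (intro pair_pre_digraph.equality) (auto simp: induced_def dest: in_arcsD1 in_arcsD2)
  then show ?case using assms(1) by simp
next
  case (insert v T)
  have "delete_vertex (induced H (pverts H - T)) v = induced H (pverts H - insert v T)"
    by (auto simp: delete_vertex_def induced_def)
  moreover have "v \<in> pverts (induced H (pverts H - T))" using insert by (simp add: induced_def)
  ultimately show ?case using insert pivot_minor_delete by (metis insert_subset)
qed

text \<open>A vertex is sent to its position on the path. Since the path may be too long, only its
  first \<open>m\<close> vertices are kept.\<close>

lemma digraph_iso_path_graph:
  assumes p: "induced_path (adj H) p" and m: "m \<le> length p"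
  shows "digraph_iso (with_proj (induced H (set (take m p)))) (with_proj (path_graph m))"
proof -
  let ?S = "set (take m p)" and ?K = "induced H (set (take m p))"
  let ?f = "the_inv_into {..<m} ((!) p)"
  have inj: "inj_on ((!) p) {..<m}"
    using p m by (auto simp: induced_path_def inj_on_def nth_eq_iff_index_eq)
  have S: "?S = (!) p ` {..<m}" using nth_image[OF m] by (simp add: lessThan_atLeast0)
  have f: "?f (p ! i) = i" if "i < m" for i using the_inv_into_f_f[OF inj] that by simp
  have inj_f: "inj_on ?f ?S" unfolding S by (rule inj_on_the_inv_into[OF inj])
  have e: "(p ! i, p ! j) \<in> parcs H \<longleftrightarrow> j = Suc i \<or> i = Suc j" if "i < m" "j < m" for i j
    using p m that by (simp add: induced_path_def adj_def)
  have arcs: "parcs ?K = map_prod ((!) p) ((!) p) ` parcs (path_graph m)"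
  proof -
    have "parcs ?K = map_prod ((!) p) ((!) p) ` {(i, j). i < m \<and> j < m \<and> (p ! i, p ! j) \<in> parcs H}"
      unfolding induced_def S by force
    also have "{(i, j). i < m \<and> j < m \<and> (p ! i, p ! j) \<in> parcs H} = parcs (path_graph m)"
      using e by (auto simp: path_graph_def)
    finally show ?thesis .
  qed
  let ?h = "\<lparr> iso_verts = ?f, iso_arcs = map_prod ?f ?f, iso_head = snd, iso_tail = fst \<rparr>"
  have "pre_digraph.digraph_isomorphism (with_proj ?K) ?h"
    unfolding pre_digraph.digraph_isomorphism_def
  proof (intro conjI)
    show "wf_digraph (with_proj ?K)" by unfold_locales (auto simp: induced_def)
    show "inj_on (iso_verts ?h) (verts (with_proj ?K))" using inj_f by (simp add: induced_def)
    have "inj_on (map_prod ?f ?f) (?S \<times> ?S)" using map_prod_inj_on[OF inj_f inj_f] .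
    then show "inj_on (iso_arcs ?h) (arcs (with_proj ?K))"
      by (rule inj_on_subset[THEN inj_on_cong[THEN iffD1, rotated]]) (auto simp: induced_def)
  qed auto
  moreover have "with_proj (path_graph m) = app_iso ?h (with_proj ?K)"
  proof -
    have "?f ` ?S = {..<m}" unfolding S image_image using f by simp
    moreover have "map_prod ?f ?f ` parcs ?K = (\<lambda>e. e) ` parcs (path_graph m)"
      unfolding arcs image_image by (rule image_cong) (use f in \<open>auto simp: path_graph_def\<close>)
    ultimately show ?thesis
      by (simp add: app_iso_def with_proj_def path_graph_def induced_def)
  qed
  ultimately show ?thesis unfolding digraph_iso_def by blast
qed

lemma pivot_minor_if_path_minor:
  assumes "path_minor (pverts H) r m (adj H)" "pivot_minor H G" "pair_wf_digraph H" "finite (pverts H)"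
  shows "\<exists>K. pivot_minor K G \<and> digraph_iso (with_proj K) (with_proj (path_graph m))"
proof -
  have "\<exists>K. pivot_minor K G \<and> digraph_iso (with_proj K) (with_proj (path_graph m))"
    if "path_minor W r m E" "E = adj H" "W = pverts H" "pivot_minor H G" "pair_wf_digraph H" "finite (pverts H)" for W E H
    using that
  proof (induction arbitrary: H rule: path_minor.induct)
    case (path E p)
    let ?S = "set (take m (r # p))"
    have S: "?S \<subseteq> pverts H" using path set_take_subset[of m "r # p"] by blast
    then have "pverts H - (pverts H - ?S) = ?S" by auto
    then have "pivot_minor (induced H ?S) G"
      using pivot_minor_induced[of H G "pverts H - ?S"] path by (metis Diff_subset finite_Diff)
    then show ?case using digraph_iso_path_graph path by blast
  next
    case (pivot E u v)
    have "pivot_minor (pivot H u v) G"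
      using pivot by (intro pivot_minor_pivot) (auto simp: adj_def)
    then show ?case
      using pivot.IH[of "pivot H u v"] pivot.prems by (simp add: adj_pivot pverts_pivot pair_wf_pivot)
  qed
  then show ?thesis using assms by blast
qed

section \<open>Graph distance as the length of a shortest walk\<close>

lemma pcas_relpow:
  "(\<exists>p. set p \<subseteq> R \<and> pcas u p v \<and> length p = k) \<longleftrightarrow> (u, v) \<in> R ^^ k"
proof (induction k arbitrary: u)
  case (Suc k)
  show ?case
  proof
    assume "\<exists>p. set p \<subseteq> R \<and> pcas u p v \<and> length p = Suc k"
    then obtain e p where "set (e # p) \<subseteq> R" "pcas u (e # p) v" "length p = k" by (metis length_Suc_conv)
    then have "(u, snd e) \<in> R" "(snd e, v) \<in> R ^^ k" using Suc by (auto simp: prod_eq_iff)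
    then show "(u, v) \<in> R ^^ Suc k" by (rule relpow_Suc_I2)
  next
    assume "(u, v) \<in> R ^^ Suc k"
    then obtain w where w: "(u, w) \<in> R" "(w, v) \<in> R ^^ k" by (rule relpow_Suc_E2)
    then obtain p where "set p \<subseteq> R" "pcas w p v" "length p = k" using Suc by blast
    then show "\<exists>p. set p \<subseteq> R \<and> pcas u p v \<and> length p = Suc k"
      using w by (intro exI[of _ "(u, w) # p"]) auto
  qed
qed auto

lemma graph_distance_le_iff:
  assumes "pair_wf_digraph G" "u \<in> pverts G"
  shows "graph_distance G u v \<le> ereal (real k) \<longleftrightarrow> (\<exists>j \<le> k. (u, v) \<in> parcs G ^^ j)"
proof -
  interpret pair_wf_digraph G by fact
  have cost: "awalk_cost (\<lambda>_. 1) p = real (length p)" for p :: "('a \<times> 'a) list"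
    by (induction p) (auto simp: awalk_cost_def)
  have mu: "graph_distance G u v = (INF p \<in> {p. awalk u p v}. ereal (real (length p)))"
    unfolding graph_distance_def \<mu>_def cost ..
  have walk: "awalk u p v \<longleftrightarrow> set p \<subseteq> parcs G \<and> pcas u p v" for p
    using assms(2) by (simp add: awalk_def)
  show ?thesis
  proof
    assume "graph_distance G u v \<le> ereal (real k)"
    \<comment> \<open>Only a strict bound on an infimum yields a walk below it; as lengths are
      integers, \<open>< Suc k\<close> gives back \<open>\<le> k\<close>.\<close>
    then have "(INF p \<in> {p. awalk u p v}. ereal (real (length p))) < ereal (real (Suc k))"
      unfolding mu by (rule le_less_trans) simp
    then obtain p where "awalk u p v" "length p < Suc k" by (auto simp: INF_less_iff)
    then show "\<exists>j \<le> k. (u, v) \<in> parcs G ^^ j"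
      using pcas_relpow[of "parcs G" u v "length p"] walk by (intro exI[of _ "length p"]) auto
  next
    assume "\<exists>j \<le> k. (u, v) \<in> parcs G ^^ j"
    then obtain j where j: "j \<le> k" "(u, v) \<in> parcs G ^^ j" by blast
    then obtain p where p: "awalk u p v" "length p = j"
      using pcas_relpow[of "parcs G" u v j] walk by blast
    then have "graph_distance G u v \<le> ereal (real j)"
      unfolding mu by (intro INF_lower2[of p]) auto
    also have "\<dots> \<le> ereal (real k)" using j by simp
    finally show "graph_distance G u v \<le> ereal (real k)" .
  qed
qed

lemma dist_hered_if_distance_hereditary:
  assumes wf: "pair_wf_digraph G" and dh: "distance_hereditary G"
  shows "dist_hered (adj G) (pverts G)"
  unfolding dist_hered_def
proof (intro allI impI, elim conjE)
  interpret pair_wf_digraph G by fact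
  fix X x y k
  assume X: "X \<subseteq> pverts G" and conn: "connected_in (adj G) X" and xy: "x \<in> X" "y \<in> X"
    and walk: "(x, y) \<in> arcs_in (adj G) (pverts G) ^^ k"
  let ?H = "induced G X"
  have H: "parcs ?H = arcs_in (adj G) X" "pverts ?H = X"
    by (auto simp: induced_def arcs_in_def adj_def)
  have G: "parcs G = arcs_in (adj G) (pverts G)"
    by (auto simp: arcs_in_def adj_def dest: in_arcsD1 in_arcsD2)
  have wfH: "pair_wf_digraph ?H" by unfold_locales (auto simp: induced_def)
  have ind: "induced_subgraph (with_proj ?H) (with_proj G)"
    using X wfH wf_digraph_wp_iff[of ?H] wf_digraph_wp_iff[of G] wf
    by (auto simp: induced_subgraph_def subgraph_def compatible_def induced_def)
  have "connected (with_proj ?H)"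
    unfolding connected_def strongly_connected_def
  proof (intro conjI ballI)
    show "verts (with_proj (mk_symmetric (with_proj ?H))) \<noteq> {}" using xy by (auto simp: H)
    fix u v
    assume uv: "u \<in> verts (with_proj (mk_symmetric (with_proj ?H)))"
      "v \<in> verts (with_proj (mk_symmetric (with_proj ?H)))"
    have "(u, v) \<in> (arcs_in (adj G) X)\<^sup>*" using conn uv by (auto simp: connected_in_def H)
    then have "(u, v) \<in> (parcs (mk_symmetric (with_proj ?H)))\<^sup>*"
      by (rule rtrancl_mono[THEN subsetD, rotated]) (auto simp: parcs_mk_symmetric H)
    then show "u \<rightarrow>\<^sup>*\<^bsub>with_proj (mk_symmetric (with_proj ?H))\<^esub> v"
      unfolding reachable_def
      by (intro rtrancl_consistent_rtrancl_on)
        (use uv in \<open>auto simp: parcs_mk_symmetric H arcs_in_def\<close>)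
  qed
  then have "graph_distance ?H x y = graph_distance G x y"
    using dh ind xy H unfolding distance_hereditary_def by metis
  moreover have "graph_distance G x y \<le> ereal (real k)"
    using graph_distance_le_iff[OF wf, of x y k] walk G X xy by auto
  ultimately show "\<exists>j \<le> k. (x, y) \<in> arcs_in (adj G) X ^^ j"
    using graph_distance_le_iff[OF wfH, of x y k] H xy by simp
qed

text \<open>One ordering suffices, because the width is a minimum over the finitely many
  orderings.\<close>

lemma linear_rank_width_le:
  assumes "distinct xs" "set xs = pverts G" "cut_width_le (adj G) xs k"
  shows "linear_rank_width G \<le> k"
proof -
  have cut: "cutrk G (set (take i xs)) \<le> k" for i
  proof -
    have "rank_le (\<lambda>x y. of_bool (adj G x y)) (set (take i xs)) (set (drop i xs)) k"
      using assms(3) unfolding cut_width_le_def by (metis append_take_drop_id)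
    moreover have "pverts G - set (take i xs) = set (drop i xs)"
      using assms(1,2) set_take_disj_set_drop_if_distinct[of xs i i] set_append[of "take i xs" "drop i xs"]
      by auto
    moreover have "adjacency_matrix G = (\<lambda>x y. of_bool (adj G x y))"
      by (simp add: fun_eq_iff adjacency_matrix_def adj_def)
    ultimately show ?thesis unfolding cutrk_def by (intro submatrix_rank_le) simp
  qed
  have "ordering_width G xs \<le> k" unfolding ordering_width_def using cut by (subst Max_le_iff) auto
  moreover have "linear_rank_width G \<le> ordering_width G xs"
    unfolding linear_rank_width_def
  proof (rule Min_le)
    have "{ys. linear_ordering G ys} \<subseteq> {ys. set ys = pverts G \<and> distinct ys}" by (auto simp: linear_ordering_def)
    moreover have "finite {ys. set ys = pverts G \<and> distinct ys}"
      using finite_subset_distinct[of "pverts G"] assms(2)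
      by (metis (mono_tags, lifting) List.finite_set finite_subset mem_Collect_eq subsetI)
    ultimately show "finite (ordering_width G ` {ys. linear_ordering G ys})"
      using finite_subset by blast
  qed (use assms in \<open>auto simp: linear_ordering_def\<close>)
  ultimately show ?thesis by simp
qed

theorem theorem1p5:
  fixes n :: nat and G :: "'a pair_pre_digraph"
  assumes "n \<ge> 3"
    and "pair_graph G"
    and "pivot_minor_free (path_graph n) G"
    and "distance_hereditary G"
  shows "linear_rank_width G \<le> 2 * n - 5"
proof -
  interpret pair_graph G by fact
  have wf: "pair_wf_digraph G" by unfold_locales
  interpret simple_rel "adj G"
    by unfold_locales (auto simp: adj_def dest: arcs_symmetric no_loops')
  have none: "\<not> path_minor (pverts H) r n (adj H)"
    if "pivot_minor H G" "pair_wf_digraph H" "finite (pverts H)" for H r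
    using pivot_minor_if_path_minor[OF _ that] assms(3) unfolding pivot_minor_free_def by blast
  have "\<exists>xs. distinct xs \<and> set xs = pverts G \<and> cut_width_le (adj G) xs (2 * n - 5)"
  proof (rule ordering_if_no_path[OF assms(1), of "pverts G"])
    show "\<not> path_minor (pverts G) r n (adj G)" for r
      using none[OF pivot_minor_refl wf] pair_finite_verts by blast
    show "\<not> path_minor (pverts G) r n (piv (adj G) r x)" if "adj G r x" for r x
    proof -
      have "pivot_minor (pivot G r x) G"
        using that by (intro pivot_minor_pivot pivot_minor_refl) (simp add: adj_def)
      then show ?thesis
        using none[of "pivot G r x" r] pair_wf_pivot[OF wf] pair_finite_verts
        by (simp add: pverts_pivot adj_pivot)
    qed
    show "dist_hered (adj G) (pverts G)" using dist_hered_if_distance_hereditary wf assms(4) by blast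
  qed (use pair_finite_verts in auto)
  then show ?thesis using linear_rank_width_le by blast
qed

end
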